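(* If $(G,\sigma)$ is a balanced signed graph whose underlying graph $G$ is a triangulation, then $va(G,\sigma)\leq 3$.
   Context: All graphs are finite, simple and undirected. A signed graph $(G,\sigma)$ is a graph $G$ with a signature $\sigma:E(G)\to\{1,-1\}$; edges with signature $1$ (resp. $-1$) are positive (resp. negative). A signed graph is balanced if every cycle of it contains an even number of negative edges. A triangulation is a plane graph in which the boundary of every face (including the outer one) is a cycle on three vertices. Colors are integers. For a vertex coloring $c:V(G)\to\mathbb{Z}$ and a color $i$, $G^{c}(i,\pm)$ denotes the subgraph of $G$ whose vertices are those colored $i$ or $-i$, and whose edges are the positive edges with both ends colored $i$ or both ends colored $-i$, together with the negative edges with one end colored $i$ and the other colored $-i$. (Equivalently, the edges $uv$ with $c(u)=\sigma(uv)c(v)\in\{i,-i\}$; in particular for $i=0$ every edge joining two vertices colored $0$ is included.) A signed tree-coloring of $(G,\sigma)$ is a vertex coloring $c$ such that $G^{c}(i,\pm)$ is a forest for every color $i=c(u)$, $u\in V(G)$. Let $M_n=\{\pm1,\dots,\pm k\}$ if $n=2k$ and $M_n=\{0,\pm1,\dots,\pm k\}$ if $n=2k+1$. A signed tree-$n$-coloring is a signed tree-coloring $c:V(G)\to M_n$. The signed vertex arboricity $va(G,\sigma)$ is the minimum $n$ such that $(G,\sigma)$ admits a signed tree-$n$-coloring. *)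

theory Defs
  imports "HOL-Analysis.Analysis"
begin

text \<open>A graph is given by its vertex set \<open>V\<close> and its edge set \<open>E\<close>, each edge
  being the set of its two ends.\<close>

definition simple_graph :: "'a set \<Rightarrow> 'a set set \<Rightarrow> bool" where
  "simple_graph V E \<longleftrightarrow> finite V \<and> (\<forall>e\<in>E. e \<subseteq> V \<and> card e = 2)"

definition cycle_edges :: "'a list \<Rightarrow> 'a set set" where
  "cycle_edges vs = {{vs ! i, vs ! (Suc i mod length vs)} | i. i < length vs}"

definition is_cycle :: "'a set \<Rightarrow> 'a set set \<Rightarrow> 'a list \<Rightarrow> bool" where
  "is_cycle V E vs \<longleftrightarrow>
     length vs \<ge> 3 \<and> distinct vs \<and> set vs \<subseteq> V \<and> cycle_edges vs \<subseteq> E"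

definition is_forest :: "'a set \<Rightarrow> 'a set set \<Rightarrow> bool" where
  "is_forest V E \<longleftrightarrow> simple_graph V E \<and> (\<nexists>vs. is_cycle V E vs)"

definition signed_graph :: "'a set \<Rightarrow> 'a set set \<Rightarrow> ('a set \<Rightarrow> int) \<Rightarrow> bool" where
  "signed_graph V E \<sigma> \<longleftrightarrow> simple_graph V E \<and> (\<forall>e\<in>E. \<sigma> e \<in> {1, -1})"

definition balanced :: "'a set \<Rightarrow> 'a set set \<Rightarrow> ('a set \<Rightarrow> int) \<Rightarrow> bool" where
  "balanced V E \<sigma> \<longleftrightarrow>
     (\<forall>vs. is_cycle V E vs \<longrightarrow> even (card {e \<in> cycle_edges vs. \<sigma> e = -1}))"

text \<open>A plane graph is an abstract graph together with a drawing: \<open>\<phi>\<close> places the vertices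
  in the plane (identified with the complex numbers) and \<open>\<gamma>\<close> assigns to every edge an
  arbitrary, not necessarily polygonal, arc joining its ends.\<close>

definition plane_graph ::
  "'a set \<Rightarrow> 'a set set \<Rightarrow> ('a \<Rightarrow> complex) \<Rightarrow> ('a set \<Rightarrow> real \<Rightarrow> complex) \<Rightarrow> bool" where
  "plane_graph V E \<phi> \<gamma> \<longleftrightarrow>
     simple_graph V E \<and> inj_on \<phi> V \<and>
     (\<forall>e\<in>E. arc (\<gamma> e) \<and> {pathstart (\<gamma> e), pathfinish (\<gamma> e)} = \<phi> ` e) \<and>
     (\<forall>e\<in>E. (path_image (\<gamma> e) - \<phi> ` e) \<inter> \<phi> ` V = {}) \<and>
     (\<forall>e\<in>E. \<forall>f\<in>E. e \<noteq> f \<longrightarrow> (path_image (\<gamma> e) - \<phi> ` e) \<inter> path_image (\<gamma> f) = {})"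

definition plane_faces ::
  "'a set \<Rightarrow> 'a set set \<Rightarrow> ('a \<Rightarrow> complex) \<Rightarrow> ('a set \<Rightarrow> real \<Rightarrow> complex) \<Rightarrow> complex set set" where
  "plane_faces V E \<phi> \<gamma> = components (- (\<phi> ` V \<union> (\<Union>e\<in>E. path_image (\<gamma> e))))"

text \<open>The unbounded (outer) face is one of the components, so it is covered too. The name
  \<open>triangulation\<close> is already used in the library for collections of simplices.\<close>

definition plane_triangulation ::
  "'a set \<Rightarrow> 'a set set \<Rightarrow> ('a \<Rightarrow> complex) \<Rightarrow> ('a set \<Rightarrow> real \<Rightarrow> complex) \<Rightarrow> bool" where
  "plane_triangulation V E \<phi> \<gamma> \<longleftrightarrow>
     plane_graph V E \<phi> \<gamma> \<and>
     (\<forall>F \<in> plane_faces V E \<phi> \<gamma>. \<exists>vs. is_cycle V E vs \<and> length vs = 3 \<and>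
        frontier F = (\<Union>e \<in> cycle_edges vs. path_image (\<gamma> e)))"

definition color_vertices :: "'a set \<Rightarrow> ('a \<Rightarrow> int) \<Rightarrow> int \<Rightarrow> 'a set" where
  "color_vertices V c i = {v \<in> V. c v = i \<or> c v = - i}"

definition color_edges ::
  "'a set set \<Rightarrow> ('a set \<Rightarrow> int) \<Rightarrow> ('a \<Rightarrow> int) \<Rightarrow> int \<Rightarrow> 'a set set" where
  "color_edges E \<sigma> c i =
     {{u, v} | u v. {u, v} \<in> E \<and>
        (\<sigma> {u, v} = 1 \<and> (c u = i \<and> c v = i \<or> c u = - i \<and> c v = - i) \<or>
         \<sigma> {u, v} = -1 \<and> c u = i \<and> c v = - i)}"

definition signed_tree_coloring ::
  "'a set \<Rightarrow> 'a set set \<Rightarrow> ('a set \<Rightarrow> int) \<Rightarrow> ('a \<Rightarrow> int) \<Rightarrow> bool" where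
  "signed_tree_coloring V E \<sigma> c \<longleftrightarrow>
     (\<forall>u\<in>V. is_forest (color_vertices V c (c u)) (color_edges E \<sigma> c (c u)))"

definition color_set :: "nat \<Rightarrow> int set" where
  "color_set n =
     (let k = int (n div 2) in if even n then {-k..k} - {0} else {-k..k})"

definition signed_tree_n_coloring ::
  "'a set \<Rightarrow> 'a set set \<Rightarrow> ('a set \<Rightarrow> int) \<Rightarrow> nat \<Rightarrow> ('a \<Rightarrow> int) \<Rightarrow> bool" where
  "signed_tree_n_coloring V E \<sigma> n c \<longleftrightarrow>
     signed_tree_coloring V E \<sigma> c \<and> c ` V \<subseteq> color_set n"

definition signed_vertex_arboricity ::
  "'a set \<Rightarrow> 'a set set \<Rightarrow> ('a set \<Rightarrow> int) \<Rightarrow> nat" where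
  "signed_vertex_arboricity V E \<sigma> = (LEAST n. \<exists>c. signed_tree_n_coloring V E \<sigma> n c)"

text \<open>The minimum exists: give the vertices pairwise distinct positive colors.\<close>

lemma ex_signed_tree_n_coloring:
  assumes "simple_graph V E"
  shows "\<exists>n c. signed_tree_n_coloring V E \<sigma> n c"
proof -
  have fin: "finite V" and E: "\<And>e. e \<in> E \<Longrightarrow> e \<subseteq> V \<and> card e = 2"
    using assms by (auto simp: simple_graph_def)
  obtain h :: "'a \<Rightarrow> nat" where h: "inj_on h V" "h ` V = {0..<card V}"
    using ex_bij_betw_finite_nat[OF fin] by (auto simp: bij_betw_def)
  define c where "c v = int (h v) + 1" for v
  have cv: "color_vertices V c (c u) = {u}" if "u \<in> V" for u
    using that h(1) by (auto simp: color_vertices_def c_def inj_on_def)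
  have ce: "color_edges E \<sigma> c (c u) = {}" for u
  proof -
    have "u' = v'" if "{u', v'} \<in> E" "c u' = c v'" for u' v'
      using E[OF that(1)] that(2) h(1) by (auto simp: c_def inj_on_def)
    moreover have "u' \<noteq> v'" if "{u', v'} \<in> E" for u' v'
      using E[OF that] by auto
    moreover have "c x \<noteq> - c y" for x y
      by (auto simp: c_def)
    ultimately show ?thesis
      by (auto simp: color_edges_def) metis+
  qed
  have "is_forest (color_vertices V c (c u)) (color_edges E \<sigma> c (c u))" if "u \<in> V" for u
    unfolding cv[OF that] ce is_forest_def
    by (auto simp: simple_graph_def is_cycle_def cycle_edges_def intro!: exI[of _ "0::nat"])
  moreover have "c ` V \<subseteq> color_set (2 * card V)"
  proof
    fix x assume "x \<in> c ` V"
    then obtain v where v: "v \<in> V" "x = int (h v) + 1"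
      by (auto simp: c_def)
    then have "h v \<in> {0..<card V}"
      using h(2) by blast
    then show "x \<in> color_set (2 * card V)"
      using v(2) by (auto simp: color_set_def Let_def)
  qed
  ultimately show ?thesis
    by (auto simp: signed_tree_n_coloring_def signed_tree_coloring_def)
qed

end

theory Submission imports Defs begin

text \<open>A balanced signature is a switching of the all-positive one: there is \<open>s : V \<rightarrow> {1, -1}\<close> with
  \<open>\<sigma>(uv) = s(u) s(v)\<close> for every edge (\<open>balanced_imp_switching\<close>). If \<open>c\<close> colors the vertices
  with \<open>-1, 0, 1\<close> so that every color class induces a forest of \<open>G\<close>, then \<open>s c\<close> is a signed
  tree-\<open>3\<close>-coloring (\<open>switching_arboricity_le_3\<close>). It remains to find such a \<open>c\<close>, that is, to
  show that plane graphs have vertex arboricity at most \<open>3\<close>.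

  Every nonempty plane graph has a vertex of degree at most \<open>5\<close> (\<open>plane_graph_low_degree\<close>).
  When such a vertex is colored after all the others, one of the three colors occurs at most once
  among its neighbours, and with this color the vertex lies on no monochromatic cycle
  (\<open>degenerate_imp_tree_coloring\<close>).

  The bound on the degree comes from Euler's formula, of which only the inequality
  \<open>|F| \<ge> |E| - |V| + 2\<close> is needed (\<open>euler_faces_lower\<close>), and from counting the incidences of
  faces and edges. For arcs that are merely continuous this rests on one local fact
  (\<open>locally_two_sided\<close>): near an inner point of an edge that lies on a cycle there are exactly two
  faces. The Jordan curve theorem for the cycle provides the two sides, and
  Janiszewski's theorem shows that each side belongs to one face near the point. Hence the removal
  of an edge on a cycle decreases the number of faces (\<open>card_components_add_arc\<close>), and an edge on a
  cycle is on the boundary of at most two faces (\<open>edge_two_faces\<close>). On the other hand, if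
  there are at least three edges, every face has three of them on its boundary
  (\<open>card_boundary_edges\<close>), because fewer than three edges do not separate the plane. Bridges are on no cycle; the graph is split at them before counting
  (\<open>card_edges_plane\<close>).\<close>

section \<open>Paths, cycles and bridges\<close>

fun path_edges :: "'a list \<Rightarrow> 'a set set" where
  "path_edges (x # y # zs) = insert {x, y} (path_edges (y # zs))"
| "path_edges _ = {}"

definition path_between :: "'a set set \<Rightarrow> 'a \<Rightarrow> 'a list \<Rightarrow> 'a \<Rightarrow> bool" where
  "path_between E u vs v \<longleftrightarrow>
     vs \<noteq> [] \<and> distinct vs \<and> hd vs = u \<and> last vs = v \<and> path_edges vs \<subseteq> E"

lemma path_edges_append:
  "path_edges (xs @ ys) =
     path_edges xs \<union> path_edges ys \<union> (if xs = [] \<or> ys = [] then {} else {{last xs, hd ys}})"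
proof (induction xs rule: path_edges.induct)
  case (1 x y zs)
  then show ?case by auto
next
  case ("2_2" x)
  then show ?case by (cases ys) auto
qed simp

lemma path_edges_nth: "path_edges vs = {{vs ! i, vs ! Suc i} | i. Suc i < length vs}"
proof (induction vs rule: path_edges.induct)
  case (1 x y zs)
  have "{{(x # y # zs) ! i, (x # y # zs) ! Suc i} | i. Suc i < length (x # y # zs)} =
        insert {x, y} {{(y # zs) ! i, (y # zs) ! Suc i} | i. Suc i < length (y # zs)}" (is "?L = ?R")
  proof
    show "?L \<subseteq> ?R"
    proof
      fix e assume "e \<in> ?L"
      then obtain i where "e = {(x # y # zs) ! i, (x # y # zs) ! Suc i}" "Suc i < length (x # y # zs)"
        by blast
      then show "e \<in> ?R" by (cases i) auto
    qed
    show "?R \<subseteq> ?L"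
    proof
      fix e assume "e \<in> ?R"
      then consider "e = {x, y}" | i where "e = {(y # zs) ! i, (y # zs) ! Suc i}" "Suc i < length (y # zs)"
        by blast
      then show "e \<in> ?L"
      proof cases
        case 1 then show ?thesis by (intro CollectI exI[of _ 0]) auto
      next
        case 2 then show ?thesis by (intro CollectI exI[of _ "Suc i"]) auto
      qed
    qed
  qed
  with 1 show ?case by simp
qed auto

lemma cycle_edges_eq:
  assumes "vs \<noteq> []"
  shows "cycle_edges vs = insert {last vs, hd vs} (path_edges vs)"
proof -
  have "cycle_edges vs = (\<lambda>i. {vs ! i, vs ! (Suc i mod length vs)}) ` {..<length vs}"
    by (auto simp: cycle_edges_def)
  also have "{..<length vs} = insert (length vs - 1) {..<length vs - 1}"
    using assms by (auto simp: neq_Nil_conv)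
  also have "(\<lambda>i. {vs ! i, vs ! (Suc i mod length vs)}) ` \<dots> =
      insert {last vs, hd vs} ((\<lambda>i. {vs ! i, vs ! Suc i}) ` {..<length vs - 1})"
    using assms by (auto simp: last_conv_nth hd_conv_nth)
  also have "(\<lambda>i. {vs ! i, vs ! Suc i}) ` {..<length vs - 1} = path_edges vs"
    by (auto simp: path_edges_nth)
  finally show ?thesis .
qed

lemma finite_path_edges [simp]: "finite (path_edges vs)"
  by (induction vs rule: path_edges.induct) auto

lemma path_edges_subset: "e \<in> path_edges vs \<Longrightarrow> e \<subseteq> set vs"
  by (induction vs rule: path_edges.induct) auto

lemma path_vertices_covered: "x \<in> set vs \<Longrightarrow> path_edges vs \<noteq> {} \<Longrightarrow> x \<in> \<Union>(path_edges vs)"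
proof (induction vs rule: path_edges.induct)
  case (1 a b zs)
  then show ?case by (cases zs) auto
qed auto

lemma path_between_length:
  assumes "path_between (E - {{u, v}}) u vs v" "u \<noteq> v"
  shows "length vs \<ge> 3"
proof (rule ccontr)
  assume "\<not> length vs \<ge> 3"
  then have "length vs = 0 \<or> length vs = 1 \<or> length vs = 2" by linarith
  then consider "vs = []" | x where "vs = [x]" | x y where "vs = [x, y]"
    by (auto simp: length_Suc_conv numeral_2_eq_2)
  then show False
    using assms by cases (simp_all add: path_between_def)
qed

lemma cycle_of_path:
  assumes G: "simple_graph V E" and e: "{u, v} \<in> E" and p: "path_between (E - {{u, v}}) u vs v"
  shows "is_cycle V E vs" "cycle_edges vs = insert {u, v} (path_edges vs)"
proof -
  have "card {u, v} = 2"
    using G e unfolding simple_graph_def by blast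
  then have "u \<noteq> v" by auto
  then have len: "length vs \<ge> 3" using path_between_length[OF p] by blast
  have ne: "vs \<noteq> []" using p by (auto simp: path_between_def)
  show ce: "cycle_edges vs = insert {u, v} (path_edges vs)"
    using cycle_edges_eq[OF ne] p unfolding path_between_def
    by (metis insert_commute)
  have "path_edges vs \<noteq> {}" using len by (cases vs rule: path_edges.cases) simp_all
  then have "set vs \<subseteq> \<Union>(path_edges vs)"
    by (intro subsetI path_vertices_covered)
  also have "\<dots> \<subseteq> V"
    using p G unfolding path_between_def simple_graph_def by blast
  finally show "is_cycle V E vs"
    using len p e unfolding is_cycle_def path_between_def ce by blast
qed

text \<open>The alternative behind the inductions on edges: an edge that is not on a cycle is a bridge.
  As the side \<open>A\<close> of the separation one takes the vertices that can be reached from \<open>u\<close> without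
  using the edge \<open>uv\<close>.\<close>

lemma path_or_bridge:
  assumes G: "simple_graph V E" and e: "{u, v} \<in> E"
  obtains vs where "path_between (E - {{u, v}}) u vs v"
  | A where "A \<subseteq> V" "u \<in> A" "v \<in> V - A" "\<And>f. f \<in> E - {{u, v}} \<Longrightarrow> f \<subseteq> A \<or> f \<subseteq> V - A"
proof -
  let ?E = "E - {{u, v}}"
  define A where "A = {w \<in> V. \<exists>vs. path_between ?E u vs w}"
  have uv: "u \<in> V" "v \<in> V"
    using assms by (auto simp: simple_graph_def)
  have extend: "x \<in> A" if w: "w \<in> A" and f: "{w, x} \<in> ?E" for w x
  proof -
    obtain vs where vs: "path_between ?E u vs w"
      using w by (auto simp: A_def)
    have x: "x \<in> V" using f G by (auto simp: simple_graph_def)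
    show ?thesis
    proof (cases "x \<in> set vs")
      case True
      then obtain ys zs where "vs = ys @ x # zs" by (meson split_list)
      then have eq: "vs = (ys @ [x]) @ zs" by simp
      have "path_between ?E u (ys @ [x]) x"
        using vs unfolding eq path_between_def path_edges_append[of "ys @ [x]" zs]
        by (auto simp: hd_append)
      then show ?thesis using x by (auto simp: A_def)
    next
      case False
      then have "path_between ?E u (vs @ [x]) x"
        using vs f by (auto simp: path_between_def path_edges_append)
      then show ?thesis using x by (auto simp: A_def)
    qed
  qed
  show thesis
  proof (cases "v \<in> A")
    case True
    then show ?thesis using that(1) by (auto simp: A_def)
  next
    case False
    have "path_between ?E u [u] u" by (auto simp: path_between_def)
    then have "u \<in> A" using uv by (auto simp: A_def)
    moreover have "f \<subseteq> A \<or> f \<subseteq> V - A" if f: "f \<in> ?E" for f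
    proof -
      have "card f = 2" "f \<subseteq> V" using f G by (auto simp: simple_graph_def)
      then obtain w x where "f = {w, x}" by (auto simp: card_2_iff)
      then show ?thesis
        using extend[of w x] extend[of x w] f \<open>f \<subseteq> V\<close> by (auto simp: insert_commute)
    qed
    ultimately show ?thesis
      using that(2)[of A] False uv by (auto simp: A_def)
  qed
qed

lemma simple_graph_subset:
  assumes "simple_graph V E" "W \<subseteq> V" "D \<subseteq> E" "\<And>e. e \<in> D \<Longrightarrow> e \<subseteq> W"
  shows "simple_graph W D"
  using assms by (auto simp: simple_graph_def intro: finite_subset)

lemma finite_edges: "simple_graph V E \<Longrightarrow> finite E"
  unfolding simple_graph_def by (meson PowI finite_Pow_iff finite_subset subsetI)

lemma edge_ends:
  assumes "simple_graph V E" "e \<in> E"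
  obtains u v where "e = {u, v}" "u \<noteq> v" "u \<in> V" "v \<in> V"
  using assms by (fastforce simp: simple_graph_def card_2_iff)

text \<open>This splits a count of edges into the counts on the two sides of a bridge, to which an induction
  hypothesis for smaller vertex sets applies.\<close>

lemma card_edges_bridge:
  assumes G: "simple_graph V E" and e: "{u, v} \<in> E" and A: "A \<subseteq> V"
    and sep: "\<And>f. f \<in> E - {{u, v}} \<Longrightarrow> f \<subseteq> A \<or> f \<subseteq> V - A"
  shows "card E \<le> card {f \<in> E. f \<subseteq> A} + card {f \<in> E. f \<subseteq> V - A} + 1"
proof -
  have "E \<subseteq> {f \<in> E. f \<subseteq> A} \<union> {f \<in> E. f \<subseteq> V - A} \<union> {{u, v}}"
    using sep by auto
  then have "card E \<le> card ({f \<in> E. f \<subseteq> A} \<union> {f \<in> E. f \<subseteq> V - A} \<union> {{u, v}})"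
    using finite_edges[OF G] by (intro card_mono) auto
  also have "\<dots> \<le> card {f \<in> E. f \<subseteq> A} + card {f \<in> E. f \<subseteq> V - A} + card {{u, v}}"
    by (meson card_Un_le add_le_mono le_trans order_refl)
  finally show ?thesis by simp
qed

lemma card_edges_acyclic:
  assumes "simple_graph V E" "V \<noteq> {}"
    and "\<And>u v vs. {u, v} \<in> E \<Longrightarrow> \<not> path_between (E - {{u, v}}) u vs v"
  shows "card E + 1 \<le> card V"
  using assms
proof (induction "card V" arbitrary: V E rule: less_induct)
  case less
  have fin: "finite V" using less.prems(1) by (auto simp: simple_graph_def)
  show ?case
  proof (cases "E = {}")
    case True
    then show ?thesis using less.prems fin by (simp add: Suc_le_eq card_gt_0_iff)
  next
    case False
    then obtain u v where e: "{u, v} \<in> E"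
      using edge_ends[OF less.prems(1)] by (metis ex_in_conv)
    obtain A where A: "A \<subseteq> V" "u \<in> A" "v \<in> V - A"
      "\<And>f. f \<in> E - {{u, v}} \<Longrightarrow> f \<subseteq> A \<or> f \<subseteq> V - A"
      using path_or_bridge[OF less.prems(1) e] less.prems(3)[OF e] by metis
    have part: "card {f \<in> E. f \<subseteq> W} + 1 \<le> card W" if W: "W \<subset> V" "W \<noteq> {}" for W
    proof (rule less.hyps)
      show "card W < card V" using W fin by (simp add: psubset_card_mono)
      show "simple_graph W {f \<in> E. f \<subseteq> W}"
        using W by (intro simple_graph_subset[OF less.prems(1)]) auto
      show "\<not> path_between ({f \<in> E. f \<subseteq> W} - {{x, y}}) x vs y"
        if "{x, y} \<in> {f \<in> E. f \<subseteq> W}" for x y vs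
        using less.prems(3)[of x y vs] that by (auto simp: path_between_def)
    qed (use W in auto)
    have "card V = card A + card (V - A)"
      using A(1) fin by (metis card_Diff_subset card_mono finite_subset le_add_diff_inverse)
    moreover have "card {f \<in> E. f \<subseteq> A} + 1 \<le> card A" "card {f \<in> E. f \<subseteq> V - A} + 1 \<le> card (V - A)"
      using A by (blast intro: part)+
    ultimately show ?thesis
      using card_edges_bridge[OF less.prems(1) e A(1,4)] by linarith
  qed
qed

section \<open>Balanced signatures are switchings of the all-positive one\<close>

text \<open>The product of the signs along the path telescopes, because every inner vertex occurs in two
  consecutive edges.\<close>

lemma path_negative_parity:
  fixes s :: "'a \<Rightarrow> int"
  assumes "\<And>w. s w \<in> {1, -1}"
    and "vs \<noteq> []" "distinct vs"
    and "\<And>x y. {x, y} \<in> path_edges vs \<Longrightarrow> \<sigma> {x, y} = s x * s y"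
  shows "(-1) ^ card {e \<in> path_edges vs. \<sigma> e = -1} = s (hd vs) * s (last vs)"
  using assms(2-4)
proof (induction vs rule: path_edges.induct)
  case (1 x y zs)
  let ?N = "{e \<in> path_edges (y # zs). \<sigma> e = -1}"
  have IH: "(-1) ^ card ?N = s y * s (last (y # zs))"
    using 1 by auto
  have notin: "{x, y} \<notin> path_edges (y # zs)"
    using path_edges_subset[of "{x, y}" "y # zs"] 1 by auto
  have xy: "\<sigma> {x, y} = s x * s y" using 1 by simp
  have sgn: "s x = 1 \<or> s x = -1" "s y = 1 \<or> s y = -1" using assms(1) by auto
  show ?case
  proof (cases "\<sigma> {x, y} = -1")
    case True
    then have "{e \<in> path_edges (x # y # zs). \<sigma> e = -1} = insert {x, y} ?N" by auto
    then have "card {e \<in> path_edges (x # y # zs). \<sigma> e = -1} = Suc (card ?N)"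
      using notin by simp
    moreover have "s x = - s y" using True xy sgn by auto
    ultimately show ?thesis using IH by simp
  next
    case False
    then have "{e \<in> path_edges (x # y # zs). \<sigma> e = -1} = ?N" by auto
    moreover have "s x = s y" using False xy sgn by auto
    ultimately show ?thesis using IH by simp
  qed
next
  case ("2_2" x)
  then show ?case using assms(1)[of x] by auto
qed simp

lemma mult_doubleton_cong:
  fixes s :: "'a \<Rightarrow> 'b :: ab_semigroup_mult"
  assumes "{x, y} = {u, v}"
  shows "s x * s y = s u * s v"
  using assms by (auto simp: doubleton_eq_iff mult.commute)

text \<open>Remove an edge \<open>uv\<close> and take \<open>s\<close> for the rest. If \<open>uv\<close> closes a cycle, the evenness
  of the number of negative edges on this cycle forces the right sign on \<open>uv\<close>. If \<open>uv\<close> is a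
  bridge, no cycle constrains its sign, but \<open>s\<close> may be negated on one side of the bridge.\<close>

lemma balanced_imp_switching:
  assumes "signed_graph V E \<sigma>" "balanced V E \<sigma>"
  obtains s :: "'a \<Rightarrow> int"
  where "\<And>w. s w \<in> {1, -1}" "\<And>u v. {u, v} \<in> E \<Longrightarrow> \<sigma> {u, v} = s u * s v"
proof -
  have "finite E" using assms(1) finite_edges by (auto simp: signed_graph_def)
  then have "\<exists>s :: 'a \<Rightarrow> int. (\<forall>w. s w \<in> {1, -1}) \<and> (\<forall>u v. {u, v} \<in> E \<longrightarrow> \<sigma> {u, v} = s u * s v)"
    using assms
  proof (induction E rule: finite_psubset_induct)
    case (psubset E)
    have G: "simple_graph V E" and sgn: "\<And>e. e \<in> E \<Longrightarrow> \<sigma> e \<in> {1, -1}"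
      using psubset.prems(1) by (auto simp: signed_graph_def)
    show ?case
    proof (cases "E = {}")
      case True
      then show ?thesis by (intro exI[of _ "\<lambda>_. 1"]) auto
    next
      case False
      then obtain u v where e: "{u, v} \<in> E" and uv: "u \<noteq> v"
        using edge_ends[OF G] by (metis ex_in_conv)
      let ?E = "E - {{u, v}}"
      have "signed_graph V ?E \<sigma>" "balanced V ?E \<sigma>"
        using psubset.prems
        by (auto simp: signed_graph_def simple_graph_def balanced_def is_cycle_def)
      moreover have "?E \<subset> E" using e by auto
      ultimately obtain s :: "'a \<Rightarrow> int"
        where s: "\<And>w. s w \<in> {1, -1}" "\<And>x y. {x, y} \<in> ?E \<Longrightarrow> \<sigma> {x, y} = s x * s y"
        using psubset.IH by meson
      have s_cases: "s w = 1 \<or> s w = -1" for w using s(1)[of w] by auto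
      show ?thesis
      proof (rule path_or_bridge[OF G e])
        fix vs assume p: "path_between ?E u vs v"
        let ?N = "{f \<in> path_edges vs. \<sigma> f = -1}"
        have p': "vs \<noteq> []" "distinct vs" "path_edges vs \<subseteq> ?E" "hd vs = u" "last vs = v"
          using p by (auto simp: path_between_def)
        have parity: "(-1) ^ card ?N = s u * s v"
          using path_negative_parity[of s vs \<sigma>, OF s(1) p'(1,2) s(2)] p'(3-5) by blast
        have even: "even (card {f \<in> insert {u, v} (path_edges vs). \<sigma> f = -1})"
          using cycle_of_path[OF G e p] psubset.prems(2) by (auto simp: balanced_def)
        have "\<sigma> {u, v} = s u * s v"
        proof (cases "\<sigma> {u, v} = -1")
          case True
          then have "{f \<in> insert {u, v} (path_edges vs). \<sigma> f = -1} = insert {u, v} ?N" by auto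
          moreover have "{u, v} \<notin> ?N" using p'(3) by auto
          ultimately have "odd (card ?N)" using even by simp
          then show ?thesis using parity True by simp
        next
          case False
          then have "{f \<in> insert {u, v} (path_edges vs). \<sigma> f = -1} = ?N" by auto
          then have "even (card ?N)" using even by simp
          then show ?thesis using parity False sgn[OF e] by simp
        qed
        then have "\<sigma> {x, y} = s x * s y" if "{x, y} \<in> E" for x y
          using s(2)[of x y] mult_doubleton_cong[of x y u v s] that
          by (cases "{x, y} = {u, v}") simp_all
        then show ?thesis using s(1) by blast
      next
        fix A assume A: "A \<subseteq> V" "u \<in> A" "v \<in> V - A"
          "\<And>f. f \<in> ?E \<Longrightarrow> f \<subseteq> A \<or> f \<subseteq> V - A"
        \<comment> \<open>negating \<open>s\<close> on one side of the bridge changes the product at the bridge only\<close>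
        define t where "t = (if \<sigma> {u, v} = s u * s v then 1 else - 1 :: int)"
        define s' where "s' w = (if w \<in> A then t * s w else s w)" for w
        have tt: "t * t = 1" "t = 1 \<or> t = -1" by (auto simp: t_def)
        have "s' w \<in> {1, -1}" for w
          using s_cases[of w] tt by (auto simp: s'_def)
        moreover have "\<sigma> {x, y} = s' x * s' y" if f: "{x, y} \<in> E" for x y
        proof (cases "{x, y} = {u, v}")
          case True
          have "\<sigma> {u, v} = t * s u * s v"
            using sgn[OF e] s_cases[of u] s_cases[of v] by (auto simp: t_def)
          then have "\<sigma> {u, v} = s' u * s' v" using A by (auto simp: s'_def)
          then show ?thesis using mult_doubleton_cong[OF True, of s'] True by simp
        next
          case False
          then have "{x, y} \<in> ?E" using f by blast
          then have "\<sigma> {x, y} = s x * s y" "{x, y} \<subseteq> A \<or> {x, y} \<subseteq> V - A"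
            using s(2) A(4) by auto
          then show ?thesis using tt(2) by (auto simp: s'_def)
        qed
        ultimately show ?thesis by blast
      qed
    qed
  qed
  then show thesis using that by blast
qed

section \<open>Tree-colorings of degenerate graphs\<close>

lemma cycle_two_neighbours:
  assumes c: "is_cycle V E vs" and v: "v \<in> set vs"
  obtains x y where "x \<noteq> y" "x \<in> set vs - {v}" "y \<in> set vs - {v}" "{v, x} \<in> E" "{v, y} \<in> E"
proof -
  let ?n = "length vs"
  have n: "?n \<ge> 3" "distinct vs" "cycle_edges vs \<subseteq> E"
    using c by (auto simp: is_cycle_def)
  obtain i where i: "i < ?n" "v = vs ! i" using v by (auto simp: in_set_conv_nth)
  define j where "j = (if i = 0 then ?n - 1 else i - 1)"
  define k where "k = Suc i mod ?n"
  have k: "k = (if Suc i = ?n then 0 else Suc i)" using i by (auto simp: k_def)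
  have jk: "j < ?n" "k < ?n" "j \<noteq> i" "k \<noteq> i" "j \<noteq> k" "Suc j mod ?n = i"
    unfolding k j_def using i n by auto
  have ce: "{vs ! m, vs ! (Suc m mod ?n)} \<in> cycle_edges vs" if "m < ?n" for m
    using that unfolding cycle_edges_def by blast
  have "{v, vs ! k} \<in> E"
    using ce[OF i(1)] n(3) unfolding i(2) k_def by blast
  moreover have "{v, vs ! j} \<in> E"
    using ce[OF jk(1)] n(3) unfolding i(2) jk(6) insert_commute[of "vs ! i"] by blast
  moreover have "vs ! k \<noteq> vs ! j" "vs ! k \<noteq> v" "vs ! j \<noteq> v"
    unfolding i(2) using i(1) jk(1-5) n(2) by (simp_all add: nth_eq_iff_index_eq)
  moreover have "vs ! k \<in> set vs" "vs ! j \<in> set vs" using jk by simp_all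
  ultimately show thesis
    by (intro that[of "vs ! k" "vs ! j"]) simp_all
qed

text \<open>Colors are assigned greedily: a vertex with at most \<open>d\<close> neighbours sees some color of \<open>K\<close>
  at most once, as \<open>d < 2 * card K\<close>, and giving it that color closes no monochromatic cycle,
  because a cycle enters and leaves the vertex through two different neighbours.\<close>

lemma degenerate_imp_tree_coloring:
  assumes "finite V" "d < 2 * card K"
    and "\<And>W. W \<subseteq> V \<Longrightarrow> W \<noteq> {} \<Longrightarrow> \<exists>v\<in>W. card {w \<in> W. {v, w} \<in> E} \<le> d"
  obtains c where "c ` V \<subseteq> K" "\<And>vs k. is_cycle V E vs \<Longrightarrow> \<exists>x\<in>set vs. c x \<noteq> k"
proof -
  have "\<exists>c. c ` V \<subseteq> K \<and> (\<forall>vs k. is_cycle V E vs \<longrightarrow> (\<exists>x\<in>set vs. c x \<noteq> k))"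
    using assms(1,3)
  proof (induction V rule: finite_psubset_induct)
    case (psubset V)
    show ?case
    proof (cases "V = {}")
      case True
      then show ?thesis by (auto simp: is_cycle_def)
    next
      case False
      then obtain v where v: "v \<in> V" and deg: "card {w \<in> V. {v, w} \<in> E} \<le> d"
        using psubset.prems by blast
      have "V - {v} \<subset> V" using v by auto
      then have "\<exists>c. c ` (V - {v}) \<subseteq> K \<and>
          (\<forall>vs k. is_cycle (V - {v}) E vs \<longrightarrow> (\<exists>x\<in>set vs. c x \<noteq> k))"
      proof (rule psubset.IH)
        fix W assume "W \<subseteq> V - {v}" "W \<noteq> {}"
        then show "\<exists>v\<in>W. card {w \<in> W. {v, w} \<in> E} \<le> d"
          by (intro psubset.prems) auto
      qed
      then obtain c where c: "c ` (V - {v}) \<subseteq> K"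
        and acyc: "\<forall>vs k. is_cycle (V - {v}) E vs \<longrightarrow> (\<exists>x\<in>set vs. c x \<noteq> k)"
        by (elim exE conjE)
      have "\<exists>k\<in>K. card {w \<in> V - {v}. {v, w} \<in> E \<and> c w = k} \<le> 1"
      proof (rule ccontr)
        assume "\<not> ?thesis"
        then have two: "2 \<le> card {w \<in> V - {v}. {v, w} \<in> E \<and> c w = k}" if "k \<in> K" for k
          using that by auto
        have "finite K" using assms(2) by (metis card.infinite mult_0_right not_less_zero)
        have "2 * card K = (\<Sum>k\<in>K. 2)" by simp
        also have "\<dots> \<le> (\<Sum>k\<in>K. card {w \<in> V - {v}. {v, w} \<in> E \<and> c w = k})"
          by (intro sum_mono two)
        also have "\<dots> = card (\<Union>k\<in>K. {w \<in> V - {v}. {v, w} \<in> E \<and> c w = k})"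
          using \<open>finite K\<close> psubset.hyps by (intro card_UN_disjoint[symmetric]) auto
        also have "\<dots> \<le> card {w \<in> V. {v, w} \<in> E}"
          using psubset.hyps by (intro card_mono) auto
        finally show False using deg assms(2) by linarith
      qed
      then obtain k where k: "k \<in> K" "card {w \<in> V - {v}. {v, w} \<in> E \<and> c w = k} \<le> 1"
        by blast
      have single: "x = y" if "x \<in> V - {v}" "y \<in> V - {v}" "{v, x} \<in> E" "{v, y} \<in> E" "c x = k" "c y = k"
        for x y
        using that k(2) psubset.hyps card_le_Suc0_iff_eq[of "{w \<in> V - {v}. {v, w} \<in> E \<and> c w = k}"]
        by auto
      have "\<exists>x\<in>set vs. (c(v := k)) x \<noteq> m" if cyc: "is_cycle V E vs" for vs m
      proof (cases "v \<in> set vs")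
        case True
        then obtain x y where xy: "x \<noteq> y" "x \<in> set vs - {v}" "y \<in> set vs - {v}" "{v, x} \<in> E" "{v, y} \<in> E"
          using cycle_two_neighbours[OF cyc] by metis
        have "set vs \<subseteq> V" using cyc by (auto simp: is_cycle_def)
        then have "c x \<noteq> k \<or> c y \<noteq> k" using single[of x y] xy by auto
        moreover have "(c(v := k)) v = k" "(c(v := k)) x = c x" "(c(v := k)) y = c y"
          using xy by auto
        ultimately show ?thesis using True xy by (metis DiffD1)
      next
        case False
        then have "is_cycle (V - {v}) E vs" using cyc by (auto simp: is_cycle_def)
        then obtain x where "x \<in> set vs" "c x \<noteq> m" using acyc by blast
        then show ?thesis using False by (intro bexI[of _ x]) auto
      qed
      moreover have "(c(v := k)) ` V \<subseteq> K" using c k v by auto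
      ultimately show ?thesis by blast
    qed
  qed
  then show thesis using that by blast
qed

lemma color_constant_on_cycle:
  assumes "is_cycle V E vs" "\<And>x y. {x, y} \<in> E \<Longrightarrow> c x = c y" "x \<in> set vs"
  shows "c x = c (hd vs)"
proof -
  have sub: "path_edges vs \<subseteq> E" and ne: "vs \<noteq> []"
    using assms(1) cycle_edges_eq[of vs] by (fastforce simp: is_cycle_def)+
  have "c (vs ! i) = c (vs ! 0)" if "i < length vs" for i
    using that
  proof (induction i)
    case (Suc i)
    then have "{vs ! i, vs ! Suc i} \<in> path_edges vs" by (auto simp: path_edges_nth)
    then have "c (vs ! i) = c (vs ! Suc i)" using sub assms(2) by blast
    then show ?case using Suc by simp
  qed simp
  then show ?thesis using assms(3) ne by (metis hd_conv_nth in_set_conv_nth)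
qed

text \<open>Multiplication by \<open>s\<close> turns the relation \<open>c u = \<sigma>(uv) * c v\<close> of the signed coloring into the
  equation \<open>c u = c v\<close>. So the graph of the signed colors \<open>i\<close> and \<open>-i\<close> consists of
  monochromatic edges of the unsigned coloring, and a cycle in it would be monochromatic.\<close>

lemma switching_arboricity_le_3:
  fixes s :: "'a \<Rightarrow> int" and c :: "'a \<Rightarrow> int"
  assumes G: "simple_graph V E"
    and s: "\<And>w. s w \<in> {1, -1}" "\<And>u v. {u, v} \<in> E \<Longrightarrow> \<sigma> {u, v} = s u * s v"
    and c: "c ` V \<subseteq> {-1..1}" "\<And>vs k. is_cycle V E vs \<Longrightarrow> \<exists>x\<in>set vs. c x \<noteq> k"
  shows "signed_tree_n_coloring V E \<sigma> 3 (\<lambda>v. s v * c v)"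
proof -
  let ?c = "\<lambda>v. s v * c v"
  have s_cases: "s w = 1 \<or> s w = -1" for w using s(1)[of w] by auto
  have edge: "{x, y} \<in> E \<and> {x, y} \<subseteq> color_vertices V ?c i \<and> c x = c y"
    if xy: "{x, y} \<in> color_edges E \<sigma> ?c i" for x y i
  proof -
    obtain u v where uv: "{x, y} = {u, v}" "{u, v} \<in> E"
      "\<sigma> {u, v} = 1 \<and> (?c u = i \<and> ?c v = i \<or> ?c u = - i \<and> ?c v = - i) \<or>
       \<sigma> {u, v} = -1 \<and> ?c u = i \<and> ?c v = - i"
      using xy unfolding color_edges_def by blast
    have "c u = c v"
      using s(2)[OF uv(2)] uv(3) s_cases[of u] s_cases[of v] by auto
    moreover have "{u, v} \<subseteq> V" using uv(2) G by (auto simp: simple_graph_def)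
    ultimately show ?thesis
      using uv by (auto simp: color_vertices_def doubleton_eq_iff insert_commute)
  qed
  have "is_forest (color_vertices V ?c i) (color_edges E \<sigma> ?c i)" for i
    unfolding is_forest_def
  proof
    have sub: "color_edges E \<sigma> ?c i \<subseteq> E" by (auto simp: color_edges_def)
    show "simple_graph (color_vertices V ?c i) (color_edges E \<sigma> ?c i)"
    proof (rule simple_graph_subset[OF G _ sub])
      show "e \<subseteq> color_vertices V ?c i" if e: "e \<in> color_edges E \<sigma> ?c i" for e
        using edge_ends[OF G subsetD[OF sub e]] edge e by metis
    qed (auto simp: color_vertices_def)
    show "\<nexists>vs. is_cycle (color_vertices V ?c i) (color_edges E \<sigma> ?c i) vs"
    proof
      assume "\<exists>vs. is_cycle (color_vertices V ?c i) (color_edges E \<sigma> ?c i) vs"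
      then obtain vs where vs: "is_cycle (color_vertices V ?c i) (color_edges E \<sigma> ?c i) vs" ..
      have "c x = c (hd vs)" if "x \<in> set vs" for x
        using color_constant_on_cycle[OF vs _ that, of c] edge by blast
      moreover have "is_cycle V E vs"
        using vs sub by (auto simp: is_cycle_def color_vertices_def)
      ultimately show False using c(2) by blast
    qed
  qed
  moreover have "?c ` V \<subseteq> color_set 3"
  proof -
    have "?c v \<in> {-1..1}" if "v \<in> V" for v
      using c(1) that s_cases[of v] by (auto simp: image_subset_iff)
    then show ?thesis by (auto simp: color_set_def Let_def)
  qed
  ultimately show ?thesis
    by (auto simp: signed_tree_n_coloring_def signed_tree_coloring_def)
qed

section \<open>Both sides of an edge on a closed curve\<close>

text \<open>Two points close to \<open>p\<close> and on the same side of the closed curve \<open>C\<close> formed by the arcs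
  \<open>g\<close> and \<open>h\<close> can be joined close to \<open>p\<close> off \<open>C\<close>. Janiszewski's theorem is applied to \<open>C\<close> and
  to the union of a small circle around \<open>p\<close> with the part of \<open>C\<close> that remains when a subarc
  around \<open>p\<close> is cut out: their intersection is that remaining part, hence connected.\<close>

lemma same_side_locally_connected:
  fixes g h :: "real \<Rightarrow> complex"
  assumes g: "arc g" and h: "arc h"
    and ends: "pathstart h = pathfinish g" "pathfinish h = pathstart g"
    and R: "closed R" "path_image h \<subseteq> R"
    and p: "p \<in> path_image g" "p \<notin> R"
    and Q: "connected Q" "Q \<inter> (path_image g \<union> path_image h) = {}"
  obtains r where "r > 0" "ball p r \<inter> R = {}"
    "\<And>x y. x \<in> ball p r \<inter> Q \<Longrightarrow> y \<in> ball p r \<inter> Q \<Longrightarrow>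
       connected_component (- (R \<union> path_image g)) x y"
proof -
  let ?C = "path_image g \<union> path_image h"
  \<comment> \<open>inside the disc of radius \<open>\<rho>\<close> only \<open>g\<close> has to be avoided\<close>
  obtain \<rho> where \<rho>: "\<rho> > 0" "ball p \<rho> \<inter> R = {}"
    using R(1) p(2) by (metis Compl_iff disjoint_eq_subset_Compl openE open_Compl)
  obtain t where t: "t \<in> {0..1}" "g t = p"
    using p(1) by (auto simp: path_image_def)
  have "g 0 \<in> R" "g 1 \<in> R"
    using R(2) ends by (metis pathfinish_def pathfinish_in_path_image pathstart_def
      pathstart_in_path_image subsetD)+
  with t p have t01: "0 < t" "t < 1"
    by (metis atLeastAtMost_iff less_eq_real_def)+
  have cont: "continuous_on {0..1} g" and inj: "inj_on g {0..1}"
    using g by (auto simp: arc_def path_def)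
  obtain d where d: "d > 0" "\<And>s. s \<in> {0..1} \<Longrightarrow> dist s t < d \<Longrightarrow> dist (g s) p < \<rho>"
    using cont t \<rho>(1) unfolding continuous_on_iff by metis
  define \<delta> where "\<delta> = min (d / 2) (min t (1 - t))"
  have \<delta>: "\<delta> > 0" "\<delta> \<le> t" "\<delta> \<le> 1 - t" "\<delta> < d"
    using d(1) t01 by (auto simp: \<delta>_def)
  define C' where "C' = (g ` {0..t - \<delta>} \<union> path_image h) \<union> g ` {t + \<delta>..1}"
  have "connected C'"
  proof -
    have sub: "{0..t - \<delta>} \<subseteq> {0..1}" "{t + \<delta>..1} \<subseteq> {0..1}" using \<delta> t01 by auto
    have c: "connected (g ` {0..t - \<delta>})" "connected (g ` {t + \<delta>..1})"
      using continuous_on_subset[OF cont] sub by (auto intro!: connected_continuous_image)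
    have "g 0 \<in> g ` {0..t - \<delta>} \<inter> path_image h"
      using \<delta> ends by (auto simp: pathstart_def pathfinish_def path_image_def image_iff)
        (metis atLeastAtMost_iff order_refl zero_le_one)
    moreover have "g 1 \<in> (g ` {0..t - \<delta>} \<union> path_image h) \<inter> g ` {t + \<delta>..1}"
      using \<delta> ends by (auto simp: pathstart_def pathfinish_def path_image_def image_iff)
        (metis atLeastAtMost_iff order_refl zero_le_one)
    ultimately show ?thesis
      unfolding C'_def using c connected_path_image[OF arc_imp_path[OF h]]
      by (intro connected_Un) auto
  qed
  have "compact C'"
    unfolding C'_def using continuous_on_subset[OF cont] \<delta> t01 h
    by (intro compact_Un compact_continuous_image compact_arc_image) auto
  have "p \<notin> C'"
  proof
    assume "p \<in> C'"
    then have "p \<in> g ` ({0..t - \<delta>} \<union> {t + \<delta>..1})"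
      using p R(2) unfolding C'_def by blast
    then obtain s where s: "g t = g s" "s \<in> {0..t - \<delta>} \<union> {t + \<delta>..1}"
      unfolding t(2)[symmetric] by (rule imageE)
    then have "t = s" using inj_onD[OF inj s(1)] t(1) \<delta> by auto
    then show False using s(2) \<delta>(1) by auto
  qed
  have cut: "?C - C' \<subseteq> ball p \<rho>"
  proof
    fix z assume z: "z \<in> ?C - C'"
    then obtain s where s: "s \<in> {0..1}" "z = g s" by (auto simp: C'_def path_image_def)
    have "s \<notin> {0..t - \<delta>}" "s \<notin> {t + \<delta>..1}" using z s by (auto simp: C'_def)
    then have "dist s t < d" using s(1) \<delta>(4) by (auto simp: dist_real_def)
    then show "z \<in> ball p \<rho>" using d(2) s by (auto simp: dist_commute)
  qed
  have C'C: "C' \<subseteq> ?C"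
    using \<delta> t01 by (auto simp: C'_def path_image_def)
  obtain r0 where r0: "r0 > 0" "ball p r0 \<inter> C' = {}"
    using compact_imp_closed[OF \<open>compact C'\<close>] \<open>p \<notin> C'\<close>
    by (metis Compl_iff disjoint_eq_subset_Compl openE open_Compl)
  define r where "r = min r0 \<rho>"
  have r: "r > 0" "ball p r \<subseteq> ball p \<rho>" "ball p r \<inter> C' = {}"
    using r0 \<rho> by (auto simp: r_def)
  let ?T = "sphere p \<rho> \<union> C'"
  have "connected_component (- (R \<union> path_image g)) x y"
    if x: "x \<in> ball p r \<inter> Q" and y: "y \<in> ball p r \<inter> Q" for x y
  proof -
    have "?C \<inter> ?T = C'" using cut C'C by auto
    moreover have "connected_component (- ?C) x y"
      using Q x y unfolding connected_component_def by (intro exI[of _ Q]) auto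
    moreover have "connected_component (- ?T) x y"
      using x y r unfolding connected_component_def by (intro exI[of _ "ball p r"]) auto
    moreover have "compact ?C" "closed ?T"
      using g h \<open>compact C'\<close>
      by (auto intro!: compact_Un compact_arc_image closed_Un compact_imp_closed)
    ultimately have "connected_component (- (?C \<union> ?T)) x y"
      using \<open>connected C'\<close> Janiszewski[of ?C ?T x y] by metis
    then obtain K where K: "connected K" "K \<inter> ?C = {}" "K \<inter> sphere p \<rho> = {}" "x \<in> K" "y \<in> K"
      unfolding connected_component_def by blast
    have "K \<subseteq> ball p \<rho>"
    proof (rule ccontr)
      assume "\<not> K \<subseteq> ball p \<rho>"
      moreover have "K \<inter> ball p \<rho> \<noteq> {}" using K(4) x r(2) by blast
      ultimately have "K \<inter> frontier (ball p \<rho>) \<noteq> {}"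
        using K(1) by (intro connected_Int_frontier) auto
      then show False using K(3) \<rho>(1) by auto
    qed
    then show ?thesis
      using K \<rho>(2) unfolding connected_component_def by (intro exI[of _ K]) auto
  qed
  then show thesis using that[of r] r \<rho>(2) by blast
qed

text \<open>Every point of a Jordan curve lies on the frontier of both its sides, and near \<open>p\<close> the points of
  one side all belong to one component. The two components are different since already the curve
  formed by \<open>g\<close> and \<open>h\<close> separates them.\<close>

lemma locally_two_sided:
  fixes g h :: "real \<Rightarrow> complex"
  assumes g: "arc g" and h: "arc h"
    and ends: "pathstart h = pathfinish g" "pathfinish h = pathstart g"
    and R: "closed R" "path_image h \<subseteq> R" "path_image g \<inter> R \<subseteq> {pathstart g, pathfinish g}"
    and p: "p \<in> path_image g" "p \<notin> R"
  obtains r A B where "r > 0" "ball p r \<inter> R = {}" "A \<noteq> B"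
    "A \<in> components (- (R \<union> path_image g))" "B \<in> components (- (R \<union> path_image g))"
    "ball p r - path_image g \<subseteq> A \<union> B"
    "ball p r \<inter> path_image g \<subseteq> closure A \<inter> closure B"
proof -
  let ?C = "path_image g \<union> path_image h" and ?X = "R \<union> path_image g"
  have "simple_path (g +++ h)"
    using g h ends R by (intro simple_path_join_loop) auto
  moreover have "pathfinish (g +++ h) = pathstart (g +++ h)" using ends by simp
  ultimately obtain I J where IJ: "open I" "connected I" "open J" "connected J" "I \<inter> J = {}"
    "I \<union> J = - ?C" "frontier I = ?C" "frontier J = ?C"
    using Jordan_curve[of "g +++ h"] ends by (metis path_image_join)
  have CX: "?C \<subseteq> ?X" using R(2) by auto
  obtain r1 where r1: "r1 > 0" "ball p r1 \<inter> R = {}"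
    "\<And>x y. x \<in> ball p r1 \<inter> I \<Longrightarrow> y \<in> ball p r1 \<inter> I \<Longrightarrow> connected_component (- ?X) x y"
    using same_side_locally_connected[OF g h ends R(1,2) p, of I] IJ by blast
  obtain r2 where r2: "r2 > 0" "ball p r2 \<inter> R = {}"
    "\<And>x y. x \<in> ball p r2 \<inter> J \<Longrightarrow> y \<in> ball p r2 \<inter> J \<Longrightarrow> connected_component (- ?X) x y"
    using same_side_locally_connected[OF g h ends R(1,2) p, of J] IJ by blast
  define r where "r = min r1 r2"
  have r: "r > 0" "ball p r \<subseteq> ball p r1" "ball p r \<subseteq> ball p r2" using r1 r2 by (auto simp: r_def)
  have dense: "ball p r \<inter> path_image g \<subseteq> closure (ball p r \<inter> S)" if "frontier S = ?C" for S
    using that open_Int_closure_subset[OF open_ball, of p r S] by (auto simp: frontier_def)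
  have "p \<in> ball p r \<inter> path_image g" using r p by auto
  then have "ball p r \<inter> I \<noteq> {}" "ball p r \<inter> J \<noteq> {}"
    using dense[of I] dense[of J] IJ by (metis closure_empty empty_iff subsetD)+
  then obtain x y where x: "x \<in> ball p r" "x \<in> I" and y: "y \<in> ball p r" "y \<in> J" by blast
  define A where "A = connected_component_set (- ?X) x"
  define B where "B = connected_component_set (- ?X) y"
  have IA: "ball p r \<inter> I \<subseteq> A" using r1(3)[of x] x r(2) unfolding A_def by blast
  have JB: "ball p r \<inter> J \<subseteq> B" using r2(3)[of y] y r(3) unfolding B_def by blast
  have xy: "x \<in> - ?X" "y \<in> - ?X" using x y r1(2) r(2) IJ(6) by auto
  have "A \<noteq> B"
  proof
    assume "A = B"
    then have "y \<in> A" using JB y by auto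
    then have "connected_component (- ?C) x y"
      using CX by (auto simp: A_def intro: connected_component_of_subset)
    then obtain K where K: "connected K" "K \<subseteq> I \<union> J" "x \<in> K" "y \<in> K"
      unfolding connected_component_def IJ(6) by auto
    then show False
      using connectedD[OF K(1) IJ(1,3)] IJ(5) x y by blast
  qed
  moreover have "A \<in> components (- ?X)" "B \<in> components (- ?X)"
    using xy by (auto simp: A_def B_def components_def)
  moreover have "ball p r - path_image g \<subseteq> A \<union> B"
    using IA JB IJ(6) R(2) r r1(2) by fastforce
  moreover have "ball p r \<inter> path_image g \<subseteq> closure A \<inter> closure B"
    using dense[of I] dense[of J] closure_mono[OF IA] closure_mono[OF JB] IJ by blast
  ultimately show thesis using that[of r A B] r r1(2) by blast
qed

text \<open>Mapping a component of the smaller complement to the component of \<open>- R\<close> around it is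
  surjective, as \<open>g\<close> has no interior points. It is not injective: the two components next to a point
  of \<open>g\<close> are joined, within a disc that misses \<open>R\<close>, when \<open>g\<close> is taken away.\<close>

lemma card_components_add_arc:
  fixes g h :: "real \<Rightarrow> complex"
  assumes g: "arc g" and h: "arc h"
    and ends: "pathstart h = pathfinish g" "pathfinish h = pathstart g"
    and R: "closed R" "path_image h \<subseteq> R" "path_image g \<inter> R \<subseteq> {pathstart g, pathfinish g}"
    and fin: "finite (components (- (R \<union> path_image g)))"
  shows "finite (components (- R))"
    and "card (components (- R)) < card (components (- (R \<union> path_image g)))"
proof -
  let ?X = "R \<union> path_image g"
  \<comment> \<open>for a component \<open>A\<close>, the union has equal members: the component of \<open>- R\<close> around \<open>A\<close>\<close>
  define up where "up A = (\<Union>a\<in>A. connected_component_set (- R) a)" for A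
  have up: "up A = connected_component_set (- R) a" if A: "A \<in> components (- ?X)" "a \<in> A" for A a
  proof -
    have "connected A" "A \<subseteq> - R"
      using A by (auto simp: in_components_connected dest: in_components_subset)
    then have "connected_component (- R) a b" if "b \<in> A" for b
      using that A(2) unfolding connected_component_def by blast
    then have "connected_component_set (- R) b = connected_component_set (- R) a" if "b \<in> A" for b
      using that by (metis connected_component_eq mem_Collect_eq)
    then have "up A = (\<Union>b\<in>A. connected_component_set (- R) a)"
      unfolding up_def by (intro SUP_cong refl)
    then show ?thesis using A(2) by auto
  qed
  have two: thesis if p: "p \<in> path_image g" "p \<notin> R"
    and t: "\<And>r A B. r > 0 \<Longrightarrow> ball p r \<inter> R = {} \<Longrightarrow> A \<noteq> B \<Longrightarrow> A \<in> components (- ?X) \<Longrightarrow>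
      B \<in> components (- ?X) \<Longrightarrow> p \<in> closure A \<Longrightarrow> p \<in> closure B \<Longrightarrow> thesis" for p thesis
  proof -
    obtain r A B where *: "r > 0" "ball p r \<inter> R = {}" "A \<noteq> B"
      "A \<in> components (- ?X)" "B \<in> components (- ?X)"
      "ball p r \<inter> path_image g \<subseteq> closure A \<inter> closure B"
      using locally_two_sided[OF g h ends R p] by metis
    have "p \<in> ball p r \<inter> path_image g" using *(1) p(1) by simp
    then have "p \<in> closure A" "p \<in> closure B" using *(6) by blast+
    then show thesis using t[OF *(1-5)] by blast
  qed
  have surj: "components (- R) \<subseteq> up ` components (- ?X)"
  proof
    fix F assume F: "F \<in> components (- R)"
    have "open F" using F R(1) by (metis open_Compl open_components)
    have "F \<noteq> {}" "F \<subseteq> - R" using F in_components_nonempty in_components_subset by blast+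
    have "\<not> F \<subseteq> path_image g"
    proof
      assume sub: "F \<subseteq> path_image g"
      obtain p where "p \<in> F" using \<open>F \<noteq> {}\<close> by blast
      then have "p \<in> path_image g" "p \<notin> R" using sub \<open>F \<subseteq> - R\<close> by auto
      then show False
      proof (rule two)
        fix A assume A: "p \<in> closure A" "A \<in> components (- ?X)"
        then have "F \<inter> A \<noteq> {}"
          using open_Int_closure_eq_empty[OF \<open>open F\<close>, of A] \<open>p \<in> F\<close> by blast
        then show False using sub in_components_subset[OF A(2)] by auto
      qed
    qed
    then obtain x where x: "x \<in> F" "x \<in> - ?X" using \<open>F \<subseteq> - R\<close> by auto
    let ?A = "connected_component_set (- ?X) x"
    have A: "?A \<in> components (- ?X)" "x \<in> ?A" using x by (auto simp: components_def)
    have "F = connected_component_set (- R) x"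
      using F x(1) by (metis components_iff connected_component_eq)
    then have "F = up ?A" using up[OF A] by simp
    then show "F \<in> up ` components (- ?X)" using A by blast
  qed
  then show "finite (components (- R))" using fin finite_surj by blast
  have "\<not> inj_on up (components (- ?X))"
  proof -
    have "infinite (path_image g)"
      using g by (auto simp: path_image_def arc_def finite_image_iff)
    then have "infinite (path_image g - {pathstart g, pathfinish g})" by simp
    then have "path_image g - {pathstart g, pathfinish g} \<noteq> {}" by (rule infinite_imp_nonempty)
    then obtain p where "p \<in> path_image g" "p \<notin> R" using R(3) by blast
    then show ?thesis
    proof (rule two)
      fix r A B assume *: "r > 0" "ball p r \<inter> R = {}" "A \<noteq> B" "A \<in> components (- ?X)"
        "B \<in> components (- ?X)" "p \<in> closure A" "p \<in> closure B"
      obtain a where a: "a \<in> A" "a \<in> ball p r"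
        using *(1,6) by (metis closure_approachable dist_commute mem_ball)
      obtain b where b: "b \<in> B" "b \<in> ball p r"
        using *(1,7) by (metis closure_approachable dist_commute mem_ball)
      have "connected_component (- R) a b"
        using a b *(2) unfolding connected_component_def by (intro exI[of _ "ball p r"]) auto
      then have "up A = up B"
        using up[OF *(4) a(1)] up[OF *(5) b(1)] by (metis connected_component_eq mem_Collect_eq)
      then show ?thesis using *(3-5) by (auto simp: inj_on_def)
    qed
  qed
  then have "card (up ` components (- ?X)) < card (components (- ?X))"
    using fin by (metis card_image_le eq_card_imp_inj_on le_neq_implies_less)
  then show "card (components (- R)) < card (components (- ?X))"
    using card_mono[OF finite_imageI[OF fin] surj] by linarith
qed

section \<open>Faces of a plane graph\<close>

definition drawing ::
  "'a set \<Rightarrow> 'a set set \<Rightarrow> ('a \<Rightarrow> complex) \<Rightarrow> ('a set \<Rightarrow> real \<Rightarrow> complex) \<Rightarrow> complex set" where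
  "drawing V E \<phi> \<gamma> = \<phi> ` V \<union> (\<Union>e\<in>E. path_image (\<gamma> e))"

lemma plane_faces_drawing: "plane_faces V E \<phi> \<gamma> = components (- drawing V E \<phi> \<gamma>)"
  by (simp add: plane_faces_def drawing_def)

lemma plane_graphD:
  assumes "plane_graph V E \<phi> \<gamma>"
  shows "simple_graph V E" "inj_on \<phi> V"
    and "\<And>e. e \<in> E \<Longrightarrow> arc (\<gamma> e)"
    and "\<And>e. e \<in> E \<Longrightarrow> {pathstart (\<gamma> e), pathfinish (\<gamma> e)} = \<phi> ` e"
    and "\<And>e. e \<in> E \<Longrightarrow> (path_image (\<gamma> e) - \<phi> ` e) \<inter> \<phi> ` V = {}"
    and "\<And>e f. e \<in> E \<Longrightarrow> f \<in> E \<Longrightarrow> e \<noteq> f \<Longrightarrow>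
           (path_image (\<gamma> e) - \<phi> ` e) \<inter> path_image (\<gamma> f) = {}"
  using assms by (simp_all add: plane_graph_def)

lemma plane_graph_subgraph:
  assumes "plane_graph V E \<phi> \<gamma>" "W \<subseteq> V" "D \<subseteq> E" "\<And>e. e \<in> D \<Longrightarrow> e \<subseteq> W"
  shows "plane_graph W D \<phi> \<gamma>"
proof -
  have "simple_graph W D"
    using simple_graph_subset[OF plane_graphD(1)[OF assms(1)] assms(2-4)] .
  moreover have "inj_on \<phi> W" using plane_graphD(2)[OF assms(1)] assms(2) inj_on_subset by blast
  moreover have "(path_image (\<gamma> e) - \<phi> ` e) \<inter> \<phi> ` W = {}" if "e \<in> D" for e
    using plane_graphD(5)[OF assms(1), of e] that assms(2,3) by blast
  ultimately show ?thesis
    using plane_graphD(3,4,6)[OF assms(1)] assms(3) unfolding plane_graph_def by (meson subsetD)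
qed

lemma compact_drawing:
  assumes "plane_graph V E \<phi> \<gamma>"
  shows "compact (drawing V E \<phi> \<gamma>)"
proof -
  have "finite V" "finite E"
    using plane_graphD(1)[OF assms] finite_edges by (auto simp: simple_graph_def)
  then show ?thesis
    unfolding drawing_def using plane_graphD(3)[OF assms]
    by (intro compact_Un compact_UN finite_imp_compact compact_arc_image) auto
qed

lemma edges_meet_at_common_ends:
  assumes P: "plane_graph V E \<phi> \<gamma>" and e: "e \<in> E" and f: "f \<in> E" and ne: "e \<noteq> f"
  shows "path_image (\<gamma> e) \<inter> path_image (\<gamma> f) \<subseteq> \<phi> ` (e \<inter> f)"
proof -
  have "path_image (\<gamma> e) \<inter> path_image (\<gamma> f) \<subseteq> \<phi> ` e \<inter> \<phi> ` f"
    using plane_graphD(6)[OF P e f ne] plane_graphD(6)[OF P f e] ne by blast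
  moreover have "e \<subseteq> V" "f \<subseteq> V"
    using plane_graphD(1)[OF P] e f by (auto simp: simple_graph_def)
  ultimately show ?thesis
    using inj_on_image_Int[OF plane_graphD(2)[OF P]] by metis
qed

lemma directed_edge_arc:
  assumes P: "plane_graph V E \<phi> \<gamma>" and e: "{x, y} \<in> E"
  obtains g where "arc g" "pathstart g = \<phi> x" "pathfinish g = \<phi> y"
    "path_image g = path_image (\<gamma> {x, y})"
proof -
  have a: "arc (\<gamma> {x, y})" using plane_graphD(3)[OF P e] .
  have "pathstart (\<gamma> {x, y}) = \<phi> x \<and> pathfinish (\<gamma> {x, y}) = \<phi> y \<or>
        pathstart (\<gamma> {x, y}) = \<phi> y \<and> pathfinish (\<gamma> {x, y}) = \<phi> x"
    using plane_graphD(4)[OF P e] by (simp add: doubleton_eq_iff)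
  then show thesis
  proof
    assume "pathstart (\<gamma> {x, y}) = \<phi> x \<and> pathfinish (\<gamma> {x, y}) = \<phi> y"
    then show ?thesis using that[of "\<gamma> {x, y}"] a by simp
  next
    assume "pathstart (\<gamma> {x, y}) = \<phi> y \<and> pathfinish (\<gamma> {x, y}) = \<phi> x"
    then show ?thesis using that[of "reversepath (\<gamma> {x, y})"] a by (simp add: arc_reversepath)
  qed
qed

lemma arc_of_path:
  assumes P: "plane_graph V E \<phi> \<gamma>"
    and "distinct vs" "path_edges vs \<subseteq> E" "length vs \<ge> 2"
  shows "\<exists>h. arc h \<and> pathstart h = \<phi> (hd vs) \<and> pathfinish h = \<phi> (last vs) \<and>
             path_image h = (\<Union>e\<in>path_edges vs. path_image (\<gamma> e))"
  using assms(2-4)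
proof (induction vs rule: path_edges.induct)
  case (1 x y zs)
  have e: "{x, y} \<in> E" using 1 by simp
  obtain g where g: "arc g" "pathstart g = \<phi> x" "pathfinish g = \<phi> y"
    "path_image g = path_image (\<gamma> {x, y})"
    using directed_edge_arc[OF P e] .
  show ?case
  proof (cases "zs = []")
    case True
    then show ?thesis using g by (intro exI[of _ g]) simp
  next
    case False
    then have "length (y # zs) \<ge> 2" by (cases zs) auto
    then obtain h where h: "arc h" "pathstart h = \<phi> y" "pathfinish h = \<phi> (last (y # zs))"
      "path_image h = (\<Union>e\<in>path_edges (y # zs). path_image (\<gamma> e))"
      using 1 by auto
    have "path_image g \<inter> path_image h \<subseteq> {pathstart h}"
    proof
      fix p assume p: "p \<in> path_image g \<inter> path_image h"
      then obtain f where f: "f \<in> path_edges (y # zs)" "p \<in> path_image (\<gamma> f)" using h(4) by auto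
      have "x \<notin> f" using path_edges_subset[OF f(1)] 1(2) by auto
      then have "p \<in> \<phi> ` ({x, y} \<inter> f)"
        using edges_meet_at_common_ends[OF P e, of f] f 1(3) p g(4) by auto
      then show "p \<in> {pathstart h}" using \<open>x \<notin> f\<close> h(2) by auto
    qed
    then have "arc (g +++ h)" using g h by (intro arc_join) auto
    moreover have "path_image (g +++ h) = (\<Union>e\<in>path_edges (x # y # zs). path_image (\<gamma> e))"
      using g h by (simp add: path_image_join)
    ultimately show ?thesis using g(2) h(3) by (intro exI[of _ "g +++ h"]) simp
  qed
qed auto

text \<open>The rest of a cycle through the edge \<open>uv\<close> is an arc \<open>h\<close>, which together with the arc of \<open>uv\<close>
  forms a Jordan curve. The set \<open>R\<close> is the drawing without the edge \<open>uv\<close>.\<close>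

lemma edge_closing_arc:
  assumes P: "plane_graph V E \<phi> \<gamma>" and e: "{u, v} \<in> E"
    and p: "path_between (E - {{u, v}}) u vs v"
  defines "R \<equiv> drawing V (E - {{u, v}}) \<phi> \<gamma>" and "g \<equiv> \<gamma> {u, v}"
  obtains h where "arc g" "arc h" "pathstart h = pathfinish g" "pathfinish h = pathstart g"
    "closed R" "path_image h \<subseteq> R" "path_image g \<inter> R \<subseteq> {pathstart g, pathfinish g}"
    "drawing V E \<phi> \<gamma> = R \<union> path_image g"
proof -
  have g: "arc g" and ends: "{pathstart g, pathfinish g} = {\<phi> u, \<phi> v}"
    using plane_graphD(3,4)[OF P e] by (simp_all add: g_def)
  have "u \<noteq> v"
    using plane_graphD(1)[OF P] e by (auto simp: simple_graph_def)
  then have len: "length vs \<ge> 2" using path_between_length[OF p] by simp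
  have p': "distinct vs" "path_edges vs \<subseteq> E" "hd vs = u" "last vs = v"
    "path_edges vs \<subseteq> E - {{u, v}}"
    using p unfolding path_between_def by blast+
  obtain h where h: "arc h" "pathstart h = \<phi> u" "pathfinish h = \<phi> v"
    "path_image h = (\<Union>e\<in>path_edges vs. path_image (\<gamma> e))"
    using arc_of_path[OF P p'(1,2) len] unfolding p'(3,4) by blast
  have hR: "path_image h \<subseteq> R"
    unfolding h(4) R_def drawing_def using p'(5) by blast
  obtain h' where h': "arc h'" "path_image h' = path_image h"
    "pathstart h' = pathfinish g" "pathfinish h' = pathstart g"
  proof -
    have "pathstart g = \<phi> u \<and> pathfinish g = \<phi> v \<or> pathstart g = \<phi> v \<and> pathfinish g = \<phi> u"
      using ends by (simp add: doubleton_eq_iff)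
    then show thesis
      using that[of h] that[of "reversepath h"] h by (auto simp: arc_reversepath)
  qed
  have "plane_graph V (E - {{u, v}}) \<phi> \<gamma>"
    using plane_graphD(1)[OF P] by (intro plane_graph_subgraph[OF P]) (auto simp: simple_graph_def)
  then have "closed R"
    unfolding R_def by (intro compact_imp_closed compact_drawing)
  moreover have "path_image g \<inter> R \<subseteq> {pathstart g, pathfinish g}"
  proof -
    have "(path_image g - \<phi> ` {u, v}) \<inter> R = {}"
      unfolding R_def drawing_def g_def
      using plane_graphD(5)[OF P e] plane_graphD(6)[OF P e] by blast
    then show ?thesis unfolding ends by auto
  qed
  moreover have "drawing V E \<phi> \<gamma> = R \<union> path_image g"
    using e unfolding R_def drawing_def g_def by blast
  ultimately show thesis
    using that[of h'] g h' hR by simp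
qed

lemma card_faces_remove_edge:
  assumes P: "plane_graph V E \<phi> \<gamma>" and e: "{u, v} \<in> E"
    and p: "path_between (E - {{u, v}}) u vs v"
    and fin: "finite (plane_faces V E \<phi> \<gamma>)"
  shows "finite (plane_faces V (E - {{u, v}}) \<phi> \<gamma>)"
    and "card (plane_faces V (E - {{u, v}}) \<phi> \<gamma>) < card (plane_faces V E \<phi> \<gamma>)"
proof -
  obtain h where "arc (\<gamma> {u, v})" "arc h" "pathstart h = pathfinish (\<gamma> {u, v})"
    "pathfinish h = pathstart (\<gamma> {u, v})" "closed (drawing V (E - {{u, v}}) \<phi> \<gamma>)"
    "path_image h \<subseteq> drawing V (E - {{u, v}}) \<phi> \<gamma>"
    "path_image (\<gamma> {u, v}) \<inter> drawing V (E - {{u, v}}) \<phi> \<gamma>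
       \<subseteq> {pathstart (\<gamma> {u, v}), pathfinish (\<gamma> {u, v})}"
    and X: "drawing V E \<phi> \<gamma> = drawing V (E - {{u, v}}) \<phi> \<gamma> \<union> path_image (\<gamma> {u, v})"
    using edge_closing_arc[OF P e p] .
  note * = card_components_add_arc[OF this(1-7)]
  show "finite (plane_faces V (E - {{u, v}}) \<phi> \<gamma>)"
    "card (plane_faces V (E - {{u, v}}) \<phi> \<gamma>) < card (plane_faces V E \<phi> \<gamma>)"
    using * fin unfolding plane_faces_drawing X by blast+
qed

section \<open>Euler's formula and the number of edges\<close>

text \<open>This is the half \<open>|F| \<ge> |E| - |V| + 2\<close> of Euler's formula: edges on cycles are removed,
  each removal costing a face, until a forest with at most \<open>|V| - 1\<close> edges is left.\<close>

lemma euler_faces_lower: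
  assumes "plane_graph V E \<phi> \<gamma>" "V \<noteq> {}" "finite (plane_faces V E \<phi> \<gamma>)"
  shows "card E + 2 \<le> card V + card (plane_faces V E \<phi> \<gamma>)"
proof -
  have "finite E" using finite_edges plane_graphD(1)[OF assms(1)] by blast
  then show ?thesis
    using assms
  proof (induction E rule: finite_psubset_induct)
    case (psubset E)
    note P = psubset.prems(1) and fin = psubset.prems(3)
    note G = plane_graphD(1)[OF P]
    show ?case
    proof (cases "\<exists>u v vs. {u, v} \<in> E \<and> path_between (E - {{u, v}}) u vs v")
      case True
      then obtain u v vs where e: "{u, v} \<in> E" and p: "path_between (E - {{u, v}}) u vs v"
        by blast
      let ?E = "E - {{u, v}}"
      have "plane_graph V ?E \<phi> \<gamma>"
        using G by (intro plane_graph_subgraph[OF P]) (auto simp: simple_graph_def)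
      then have "card ?E + 2 \<le> card V + card (plane_faces V ?E \<phi> \<gamma>)"
        using card_faces_remove_edge(1)[OF P e p fin] e psubset.prems(2)
        by (intro psubset.IH) auto
      moreover have "card E = Suc (card ?E)"
        using e psubset.hyps by (metis card.remove)
      ultimately show ?thesis
        using card_faces_remove_edge(2)[OF P e p fin] by linarith
    next
      case False
      then have "card E + 1 \<le> card V"
        using card_edges_acyclic[OF G psubset.prems(2)] by blast
      moreover have "plane_faces V E \<phi> \<gamma> \<noteq> {}"
      proof -
        have "drawing V E \<phi> \<gamma> \<noteq> UNIV"
          using compact_drawing[OF P] not_compact_UNIV by metis
        then have "- drawing V E \<phi> \<gamma> \<noteq> {}" by blast
        then show ?thesis by (simp only: plane_faces_drawing components_eq_empty not_False_eq_True)
      qed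
      then have "card (plane_faces V E \<phi> \<gamma>) \<ge> 1"
        using fin by (simp add: Suc_le_eq card_gt_0_iff)
      ultimately show ?thesis by linarith
    qed
  qed
qed

text \<open>Only the interior of an edge is tested, since its ends are also approached by faces that have
  no part of the edge on their boundary.\<close>

definition boundary_edges ::
  "'a set set \<Rightarrow> ('a \<Rightarrow> complex) \<Rightarrow> ('a set \<Rightarrow> real \<Rightarrow> complex) \<Rightarrow> complex set \<Rightarrow> 'a set set" where
  "boundary_edges E \<phi> \<gamma> F = {e \<in> E. closure F \<inter> (path_image (\<gamma> e) - \<phi> ` e) \<noteq> {}}"

text \<open>Along the interior of an edge on a cycle the adjacent faces do not change, because each of
  them touches a relatively open and closed part of it; and close to one point of it there are only
  two of them.\<close>

lemma edge_two_faces: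
  assumes P: "plane_graph V E \<phi> \<gamma>" and e: "{u, v} \<in> E"
    and p: "path_between (E - {{u, v}}) u vs v"
  shows "finite {F \<in> plane_faces V E \<phi> \<gamma>. {u, v} \<in> boundary_edges E \<phi> \<gamma> F}"
    and "card {F \<in> plane_faces V E \<phi> \<gamma>. {u, v} \<in> boundary_edges E \<phi> \<gamma> F} \<le> 2"
proof -
  let ?g = "\<gamma> {u, v}" and ?R = "drawing V (E - {{u, v}}) \<phi> \<gamma>"
  let ?S = "path_image ?g - \<phi> ` {u, v}"
  obtain h where h: "arc ?g" "arc h" "pathstart h = pathfinish ?g" "pathfinish h = pathstart ?g"
    "closed ?R" "path_image h \<subseteq> ?R" "path_image ?g \<inter> ?R \<subseteq> {pathstart ?g, pathfinish ?g}"
    and X: "drawing V E \<phi> \<gamma> = ?R \<union> path_image ?g"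
    using edge_closing_arc[OF P e p] .
  have S: "?S = path_image ?g - {pathstart ?g, pathfinish ?g}"
    using plane_graphD(4)[OF P e] by simp
  have conn: "connected ?S" and ne: "?S \<noteq> {}"
    unfolding S using arc_imp_simple_path[OF h(1)]
    by (rule connected_simple_path_endless, rule nonempty_simple_path_endless)
  have loc: thesis if q: "q \<in> ?S" and t: "\<And>r A B. r > 0 \<Longrightarrow>
      A \<in> plane_faces V E \<phi> \<gamma> \<Longrightarrow> B \<in> plane_faces V E \<phi> \<gamma> \<Longrightarrow>
      ball q r \<inter> path_image ?g \<subseteq> closure A \<inter> closure B \<Longrightarrow>
      (\<And>F. F \<in> plane_faces V E \<phi> \<gamma> \<Longrightarrow> q \<in> closure F \<Longrightarrow> F = A \<or> F = B) \<Longrightarrow> thesis" for q thesis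
  proof -
    have q': "q \<in> path_image ?g" "q \<notin> ?R" using q h(7) unfolding S by blast+
    obtain r A B where *: "r > 0" "A \<in> plane_faces V E \<phi> \<gamma>" "B \<in> plane_faces V E \<phi> \<gamma>"
      "ball q r - path_image ?g \<subseteq> A \<union> B" "ball q r \<inter> path_image ?g \<subseteq> closure A \<inter> closure B"
      using locally_two_sided[OF h q'] unfolding plane_faces_drawing X by metis
    have "F = A \<or> F = B" if F: "F \<in> plane_faces V E \<phi> \<gamma>" and "q \<in> closure F" for F
    proof -
      have "ball q r \<inter> F \<noteq> {}"
        using open_Int_closure_eq_empty[OF open_ball, of q r F] \<open>q \<in> closure F\<close>
          centre_in_ball[of q r] *(1) by blast
      moreover have "F \<inter> path_image ?g = {}"
        using F in_components_subset[of F] unfolding plane_faces_drawing X by blast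
      ultimately have "F \<inter> A \<noteq> {} \<or> F \<inter> B \<noteq> {}" using *(4) by blast
      then show ?thesis
        using F *(2,3) components_nonoverlap unfolding plane_faces_drawing by blast
    qed
    then show thesis using t[OF *(1,2,3,5)] by blast
  qed
  have all: "?S \<subseteq> closure F" if F: "F \<in> plane_faces V E \<phi> \<gamma>" and touch: "closure F \<inter> ?S \<noteq> {}" for F
  proof -
    have "openin (top_of_set ?S) (?S \<inter> closure F)"
      unfolding openin_contains_ball
    proof (intro conjI ballI)
      fix q assume q: "q \<in> ?S \<inter> closure F"
      then have "q \<in> ?S" by blast
      then show "\<exists>r>0. ball q r \<inter> ?S \<subseteq> ?S \<inter> closure F"
      proof (rule loc)
        fix r A B assume *: "r > 0" "ball q r \<inter> path_image ?g \<subseteq> closure A \<inter> closure B"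
          "\<And>F. F \<in> plane_faces V E \<phi> \<gamma> \<Longrightarrow> q \<in> closure F \<Longrightarrow> F = A \<or> F = B"
        have "F = A \<or> F = B" using *(3)[OF F] q by blast
        then have "ball q r \<inter> ?S \<subseteq> ?S \<inter> closure F" using *(2) by blast
        then show ?thesis using *(1) by blast
      qed
    qed auto
    moreover have "closedin (top_of_set ?S) (?S \<inter> closure F)" by (simp add: closedin_closed_Int)
    ultimately have "?S \<inter> closure F = {} \<or> ?S \<inter> closure F = ?S"
      using conn unfolding connected_clopen by blast
    then show ?thesis using touch by blast
  qed
  obtain q where q: "q \<in> ?S" using ne by blast
  have "\<exists>A B. {F \<in> plane_faces V E \<phi> \<gamma>. {u, v} \<in> boundary_edges E \<phi> \<gamma> F} \<subseteq> {A, B}"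
    using q
  proof (rule loc)
    fix A B assume *: "\<And>F. F \<in> plane_faces V E \<phi> \<gamma> \<Longrightarrow> q \<in> closure F \<Longrightarrow> F = A \<or> F = B"
    have "F = A \<or> F = B" if "F \<in> plane_faces V E \<phi> \<gamma>" "{u, v} \<in> boundary_edges E \<phi> \<gamma> F" for F
      using * all that q unfolding boundary_edges_def by blast
    then show ?thesis by blast
  qed
  then obtain A B where AB: "{F \<in> plane_faces V E \<phi> \<gamma>. {u, v} \<in> boundary_edges E \<phi> \<gamma> F} \<subseteq> {A, B}"
    by blast
  show "finite {F \<in> plane_faces V E \<phi> \<gamma>. {u, v} \<in> boundary_edges E \<phi> \<gamma> F}"
    using AB by (rule finite_subset) simp
  have "card {F \<in> plane_faces V E \<phi> \<gamma>. {u, v} \<in> boundary_edges E \<phi> \<gamma> F} \<le> card {A, B}"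
    using AB by (intro card_mono) auto
  also have "\<dots> \<le> 2" by (cases "A = B") auto
  finally show "card {F \<in> plane_faces V E \<phi> \<gamma>. {u, v} \<in> boundary_edges E \<phi> \<gamma> F} \<le> 2" .
qed

text \<open>Two edges of a simple graph share at most one end, so Janiszewski's theorem applies to their arcs;
  the finitely many remaining vertices do not disconnect an open set.\<close>

lemma connected_complement_two_edges:
  assumes P: "plane_graph V E \<phi> \<gamma>" and T: "T \<subseteq> E" "card T \<le> 2"
  shows "connected (- drawing V T \<phi> \<gamma>)"
proof -
  have "finite E" using plane_graphD(1)[OF P] by (rule finite_edges)
  then have fin: "finite V" "finite T"
    using plane_graphD(1)[OF P] T(1) by (simp_all add: simple_graph_def finite_subset)
  have cpt: "compact (path_image (\<gamma> e))" "connected (- path_image (\<gamma> e))" if "e \<in> T" for e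
    using plane_graphD(3)[OF P, of e] that T(1)
    by (auto intro!: compact_arc_image connected_arc_complement)
  have "connected (- (\<Union>e\<in>T. path_image (\<gamma> e)))"
  proof -
    consider "T = {}" | e where "T = {e}" | e f where "T = {e, f}" "e \<noteq> f"
      using T(2) fin(2) by (metis One_nat_def card_0_eq card_1_singletonE card_2_iff le_SucE le_zero_eq
          numeral_2_eq_2)
    then show ?thesis
    proof cases
      case 3
      have ef: "e \<in> E" "f \<in> E" using 3 T(1) by auto
      obtain x y where xy: "e = {x, y}" "x \<noteq> y" using edge_ends[OF plane_graphD(1)[OF P] ef(1)] .
      obtain z w where zw: "f = {z, w}" "z \<noteq> w" using edge_ends[OF plane_graphD(1)[OF P] ef(2)] .
      have "x \<notin> f \<or> y \<notin> f" using xy zw 3(2) by auto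
      then have "\<exists>a. e \<inter> f \<subseteq> {a}" using xy(1) by auto
      then obtain a where "e \<inter> f \<subseteq> {a}" ..
      then have "path_image (\<gamma> e) \<inter> path_image (\<gamma> f) \<subseteq> {\<phi> a}"
        using edges_meet_at_common_ends[OF P ef 3(2)] by blast
      then have "connected (path_image (\<gamma> e) \<inter> path_image (\<gamma> f))"
        by (metis connected_empty connected_sing subset_singleton_iff)
      then have "connected (- (path_image (\<gamma> e) \<union> path_image (\<gamma> f)))"
        using cpt[of e] cpt[of f] 3 by (intro Janiszewski_connected) (auto intro: compact_imp_closed)
      then show ?thesis using 3 by simp
    qed (use cpt in auto)
  qed
  moreover have "open (- (\<Union>e\<in>T. path_image (\<gamma> e)))"
    using fin(2) cpt(1) by (intro open_Compl closed_UN) (auto intro: compact_imp_closed)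
  ultimately have "connected (- (\<Union>e\<in>T. path_image (\<gamma> e)) - \<phi> ` V)"
    using fin(1) by (intro connected_open_delete_finite) auto
  moreover have "- (\<Union>e\<in>T. path_image (\<gamma> e)) - \<phi> ` V = - drawing V T \<phi> \<gamma>"
    by (auto simp: drawing_def)
  ultimately show ?thesis by simp
qed

text \<open>A face whose boundary contained at most two edges would be the whole complement of these
  edges and the vertices, since that complement is connected and the face is open and closed in it.
  So there would be no further edges.\<close>

lemma card_boundary_edges:
  assumes P: "plane_graph V E \<phi> \<gamma>" and E: "card E \<ge> 3" and F: "F \<in> plane_faces V E \<phi> \<gamma>"
  shows "card (boundary_edges E \<phi> \<gamma> F) \<ge> 3"
proof (rule ccontr)
  let ?T = "boundary_edges E \<phi> \<gamma> F"
  let ?Y = "drawing V ?T \<phi> \<gamma>"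
  assume "\<not> ?thesis"
  moreover have TE: "?T \<subseteq> E" by (auto simp: boundary_edges_def)
  ultimately have conn: "connected (- ?Y)"
    by (intro connected_complement_two_edges[OF P]) auto
  have X: "closed (drawing V E \<phi> \<gamma>)" using compact_drawing[OF P] compact_imp_closed by blast
  have F': "F \<in> components (- drawing V E \<phi> \<gamma>)" using F by (simp add: plane_faces_drawing)
  have "open F" using open_components[OF _ F'] X by auto
  have "F \<noteq> {}" using F' in_components_nonempty by blast
  have FX: "F \<subseteq> - drawing V E \<phi> \<gamma>" using F' in_components_subset by blast
  moreover have YX: "?Y \<subseteq> drawing V E \<phi> \<gamma>" using TE by (auto simp: drawing_def)
  ultimately have FY: "F \<subseteq> - ?Y" by blast
  have "frontier F \<subseteq> drawing V E \<phi> \<gamma>"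
    using frontier_of_components_closed_complement[OF X F'] .
  then have fr: "frontier F \<subseteq> ?Y"
  proof -
    have "z \<in> ?Y" if z: "z \<in> frontier F" "z \<in> drawing V E \<phi> \<gamma>" for z
    proof (cases "z \<in> \<phi> ` V")
      case True
      then show ?thesis by (simp add: drawing_def)
    next
      case False
      then obtain e where e: "e \<in> E" "z \<in> path_image (\<gamma> e)" using z(2) by (auto simp: drawing_def)
      have "e \<subseteq> V" using plane_graphD(1)[OF P] e(1) unfolding simple_graph_def by blast
      then have "z \<notin> \<phi> ` e" using False by blast
      moreover have "z \<in> closure F" using z(1) by (simp add: frontier_def)
      ultimately have "e \<in> ?T" using e by (auto simp: boundary_edges_def)
      then show ?thesis using e(2) by (auto simp: drawing_def)
    qed
    then show ?thesis using \<open>frontier F \<subseteq> drawing V E \<phi> \<gamma>\<close> by blast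
  qed
  have "F = - ?Y"
  proof (rule ccontr)
    assume "F \<noteq> - ?Y"
    then have "- ?Y - F \<noteq> {}" "- ?Y \<inter> F \<noteq> {}" using FY \<open>F \<noteq> {}\<close> by auto
    then have "- ?Y \<inter> frontier F \<noteq> {}" using connected_Int_frontier[OF conn] by blast
    then show False using fr by blast
  qed
  then have XY: "drawing V E \<phi> \<gamma> \<subseteq> ?Y" using FX by blast
  have "E \<subseteq> ?T"
  proof
    fix e assume e: "e \<in> E"
    have "path_image (\<gamma> e) - \<phi> ` e \<noteq> {}"
      using nonempty_simple_path_endless[OF arc_imp_simple_path[OF plane_graphD(3)[OF P e]]]
        plane_graphD(4)[OF P e] by simp
    then obtain q where q: "q \<in> path_image (\<gamma> e) - \<phi> ` e" by blast
    then have "q \<in> ?Y" using XY e by (auto simp: drawing_def)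
    moreover have "q \<notin> \<phi> ` V" using q plane_graphD(5)[OF P e] by blast
    ultimately obtain f where f: "f \<in> ?T" "q \<in> path_image (\<gamma> f)" by (auto simp: drawing_def)
    then have "e = f" using plane_graphD(6)[OF P e, of f] TE q by blast
    then show "e \<in> ?T" using f by simp
  qed
  then have "?T = E" using TE by blast
  then show False using \<open>\<not> card ?T \<ge> 3\<close> E by simp
qed

text \<open>Without bridges, counting the pairs of a face and an edge on its boundary gives
  \<open>3 |F| \<le> 2 |E|\<close>, and this turns the lower bound on the number of faces into an upper bound on the
  number of edges.\<close>

lemma card_edges_bridgeless:
  assumes P: "plane_graph V E \<phi> \<gamma>" and "V \<noteq> {}" and E: "card E \<ge> 3"
    and cyc: "\<And>u v. {u, v} \<in> E \<Longrightarrow> \<exists>vs. path_between (E - {{u, v}}) u vs v"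
  shows "card E + 6 \<le> 3 * card V"
proof -
  let ?F = "plane_faces V E \<phi> \<gamma>" and ?B = "boundary_edges E \<phi> \<gamma>"
  have finE: "finite E" using finite_edges plane_graphD(1)[OF P] by blast
  have two: "finite {F \<in> ?F. e \<in> ?B F} \<and> card {F \<in> ?F. e \<in> ?B F} \<le> 2" if "e \<in> E" for e
  proof -
    obtain u v where uv: "e = {u, v}"
      using edge_ends[OF plane_graphD(1)[OF P] \<open>e \<in> E\<close>] by metis
    then obtain vs where "path_between (E - {{u, v}}) u vs v" using cyc \<open>e \<in> E\<close> by blast
    then show ?thesis using edge_two_faces[OF P] \<open>e \<in> E\<close> unfolding uv by blast
  qed
  have three: "card (?B F) \<ge> 3" if "F \<in> ?F" for F
    using card_boundary_edges[OF P E that] .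
  have BE: "?B F \<subseteq> E" for F by (auto simp: boundary_edges_def)
  have "?F \<subseteq> (\<Union>e\<in>E. {F \<in> ?F. e \<in> ?B F})"
  proof
    fix F assume F: "F \<in> ?F"
    then have "?B F \<noteq> {}" using three[OF F] by auto
    then show "F \<in> (\<Union>e\<in>E. {F \<in> ?F. e \<in> ?B F})" using F BE by blast
  qed
  then have finF: "finite ?F" using finE two finite_subset by blast
  have "3 * card ?F = (\<Sum>F\<in>?F. 3)" by simp
  also have "\<dots> \<le> (\<Sum>F\<in>?F. card {e \<in> E. e \<in> ?B F})"
  proof (rule sum_mono)
    fix F assume "F \<in> ?F"
    moreover have "{e \<in> E. e \<in> ?B F} = ?B F" using BE by blast
    ultimately show "3 \<le> card {e \<in> E. e \<in> ?B F}" using three by simp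
  qed
  also have "\<dots> = (\<Sum>e\<in>E. card {F \<in> ?F. e \<in> ?B F})"
    using finF finE by (intro sum_multicount_gen) auto
  also have "\<dots> \<le> (\<Sum>e\<in>E. 2)" using two by (intro sum_mono) auto
  finally have "3 * card ?F \<le> 2 * card E" by simp
  then show ?thesis
    using euler_faces_lower[OF P \<open>V \<noteq> {}\<close> finF] by linarith
qed

text \<open>Bridges are dealt with by induction on the two sides: with \<open>a\<close> and \<open>b\<close> vertices there, the
  number of edges is at most \<open>(3a - 3) + (3b - 3) + 1\<close>. The constant \<open>3\<close>, in place of the usual
  \<open>6\<close>, makes the bound true for one or two vertices as well.\<close>

lemma card_edges_plane:
  assumes "plane_graph V E \<phi> \<gamma>" "V \<noteq> {}"
  shows "card E + 3 \<le> 3 * card V"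
  using assms
proof (induction "card V" arbitrary: V E rule: less_induct)
  case less
  note P = less.prems(1)
  note G = plane_graphD(1)[OF P]
  have fin: "finite V" "finite E" using G finite_edges by (auto simp: simple_graph_def)
  have V: "card V \<ge> 1" using fin less.prems(2) by (simp add: Suc_le_eq card_gt_0_iff)
  show ?case
  proof (cases "\<forall>u v. {u, v} \<in> E \<longrightarrow> (\<exists>vs. path_between (E - {{u, v}}) u vs v)")
    case True
    show ?thesis
    proof (cases "E = {}")
      case False
      then obtain u v where e: "{u, v} \<in> E" and "u \<noteq> v"
        using edge_ends[OF G] by (metis ex_in_conv)
      then obtain vs where vs: "path_between (E - {{u, v}}) u vs v" using True by blast
      have len: "length vs \<ge> 3" using path_between_length[OF vs \<open>u \<noteq> v\<close>] .
      have "card E \<ge> 3"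
      proof -
        obtain x y z ws where "vs = x # y # z # ws"
          using len by (auto simp: numeral_3_eq_3 Suc_le_length_iff)
        then have "{{x, y}, {y, z}} \<subseteq> E - {{u, v}}" "{x, y} \<noteq> {y, z}"
          using vs by (auto simp: path_between_def doubleton_eq_iff)
        then have "card {{x, y}, {y, z}} \<le> card (E - {{u, v}})" "card {{x, y}, {y, z}} = 2"
          using fin(2) by (blast intro: card_mono finite_Diff, simp)
        moreover have "card E = Suc (card (E - {{u, v}}))"
          using e fin(2) by (metis card.remove)
        ultimately show ?thesis by linarith
      qed
      then show ?thesis
        using card_edges_bridgeless[OF P less.prems(2)] True by fastforce
    qed (use V in simp)
  next
    case False
    then obtain u v where e: "{u, v} \<in> E" and nop: "\<And>vs. \<not> path_between (E - {{u, v}}) u vs v"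
      by blast
    obtain A where A: "A \<subseteq> V" "u \<in> A" "v \<in> V - A"
      "\<And>f. f \<in> E - {{u, v}} \<Longrightarrow> f \<subseteq> A \<or> f \<subseteq> V - A"
      using path_or_bridge[OF G e] nop by metis
    have part: "card {f \<in> E. f \<subseteq> W} + 3 \<le> 3 * card W" if W: "W \<subset> V" "W \<noteq> {}" for W
    proof (rule less.hyps)
      show "card W < card V" using W fin by (simp add: psubset_card_mono)
      show "plane_graph W {f \<in> E. f \<subseteq> W} \<phi> \<gamma>"
        using W by (intro plane_graph_subgraph[OF P]) auto
    qed (use W in auto)
    have "card V = card A + card (V - A)"
      using A(1) fin by (metis card_Diff_subset card_mono finite_subset le_add_diff_inverse)
    moreover have "card {f \<in> E. f \<subseteq> A} + 3 \<le> 3 * card A"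
      "card {f \<in> E. f \<subseteq> V - A} + 3 \<le> 3 * card (V - A)"
      using A by (blast intro: part)+
    ultimately show ?thesis
      using card_edges_bridge[OF G e A(1,4)] by linarith
  qed
qed

text \<open>The degrees add up to twice the number of edges, hence to less than \<open>6 |V|\<close>.\<close>

lemma plane_graph_low_degree:
  assumes P: "plane_graph V E \<phi> \<gamma>" and "V \<noteq> {}"
  shows "\<exists>v\<in>V. card {w \<in> V. {v, w} \<in> E} \<le> 5"
proof (rule ccontr)
  assume "\<not> ?thesis"
  then have six: "6 \<le> card {w \<in> V. {v, w} \<in> E}" if "v \<in> V" for v using that by fastforce
  note G = plane_graphD(1)[OF P]
  have fin: "finite V" "finite E" using G finite_edges by (auto simp: simple_graph_def)
  have "6 * card V = (\<Sum>v\<in>V. 6)" by simp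
  also have "\<dots> \<le> (\<Sum>v\<in>V. card {e \<in> E. v \<in> e})"
  proof (rule sum_mono)
    fix v assume v: "v \<in> V"
    have "card {w \<in> V. {v, w} \<in> E} \<le> card {e \<in> E. v \<in> e}"
      using fin by (intro card_inj_on_le[of "\<lambda>w. {v, w}"]) (auto simp: inj_on_def doubleton_eq_iff)
    then show "6 \<le> card {e \<in> E. v \<in> e}" using six[OF v] by linarith
  qed
  also have "\<dots> = (\<Sum>e\<in>E. 2)"
  proof (rule sum_multicount_gen)
    have "{v \<in> V. v \<in> e} = e" if "e \<in> E" for e
      using G that unfolding simple_graph_def by blast
    then show "\<forall>e\<in>E. card {v \<in> V. v \<in> e} = 2"
      using G unfolding simple_graph_def by simp
  qed (use fin in auto)
  finally have "6 * card V \<le> 2 * card E" by simp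
  then show False using card_edges_plane[OF assms] by linarith
qed

section \<open>Balanced signed triangulations\<close>

theorem corollary5:
  fixes V :: "'a set" and E :: "'a set set" and \<sigma> :: "'a set \<Rightarrow> int"
    and \<phi> :: "'a \<Rightarrow> complex" and \<gamma> :: "'a set \<Rightarrow> real \<Rightarrow> complex"
  assumes "signed_graph V E \<sigma>"
    and "balanced V E \<sigma>"
    and "plane_triangulation V E \<phi> \<gamma>"
  shows "signed_vertex_arboricity V E \<sigma> \<le> 3"
proof -
  have P: "plane_graph V E \<phi> \<gamma>" using assms(3) by (simp add: plane_triangulation_def)
  note G = plane_graphD(1)[OF P]
  have fin: "finite V" using G by (simp add: simple_graph_def)
  \<comment> \<open>an induced subgraph of a triangulation may fail to be a triangulation, but it is a plane graph\<close>
  have low: "\<exists>v\<in>W. card {w \<in> W. {v, w} \<in> E} \<le> 5" if W: "W \<subseteq> V" "W \<noteq> {}" for W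
  proof -
    have "plane_graph W {e \<in> E. e \<subseteq> W} \<phi> \<gamma>"
      using W(1) by (intro plane_graph_subgraph[OF P]) auto
    then obtain v where v: "v \<in> W" "card {w \<in> W. {v, w} \<in> {e \<in> E. e \<subseteq> W}} \<le> 5"
      using plane_graph_low_degree W(2) by blast
    moreover have "{w \<in> W. {v, w} \<in> {e \<in> E. e \<subseteq> W}} = {w \<in> W. {v, w} \<in> E}" using v(1) by blast
    ultimately show ?thesis by auto
  qed
  obtain c :: "'a \<Rightarrow> int" where c: "c ` V \<subseteq> {-1..1}"
    "\<And>vs k. is_cycle V E vs \<Longrightarrow> \<exists>x\<in>set vs. c x \<noteq> k"
    using degenerate_imp_tree_coloring[OF fin _ low, of "{-1..1 :: int}"] by auto
  obtain s :: "'a \<Rightarrow> int" where s: "\<And>w. s w \<in> {1, -1}"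
    "\<And>u v. {u, v} \<in> E \<Longrightarrow> \<sigma> {u, v} = s u * s v"
    using balanced_imp_switching[OF assms(1,2)] by blast
  have "signed_tree_n_coloring V E \<sigma> 3 (\<lambda>v. s v * c v)"
    by (rule switching_arboricity_le_3[OF G]) (fact s c)+
  then show ?thesis
    unfolding signed_vertex_arboricity_def by (intro Least_le) blast
qed

end
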